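(* A principally polarized abelian surface $X$ of Picard number $2$ is self-mirror if and only if the discriminant of $\mathrm{NS}(X)$ is not divisible by $16$ nor by any prime $p\equiv3\pmod 4$.
   Context: Abelian surfaces are over $\mathbb{C}$. For an abelian surface $X$, $\mathrm{NS}(X)\subseteq H^2(X,\mathbb{Z})$ is the N\'eron--Severi lattice (its discriminant is the determinant of a Gram matrix) and $T(X)=\mathrm{NS}(X)^\perp\subseteq H^2(X,\mathbb{Z})$. $N(X)=H^0(X,\mathbb{Z})\oplus\mathrm{NS}(X)\oplus H^4(X,\mathbb{Z})$ carries the Mukai pairing $(r,D,s)\cdot(r',D',s')=DD'-rs'-sr'$. $X$ is self-mirror if there is a lattice isometry $T(X)\cong N(X)$. *)

theory Defs
  imports
    "HOL-Analysis.Analysis"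
    "HOL-Number_Theory.Cong"
    "HOL-Library.Function_Algebras"
    "Jordan_Normal_Form.Determinant"
begin

text \<open>
  A two-dimensional complex torus is \<open>X = \<complex>\<^sup>2 / \<Lambda>\<close>, given by its lattice \<open>\<Lambda>\<close>; an abelian surface
  is such a torus that admits a polarization. Since \<open>\<complex>\<^sup>2\<close> is the universal cover of \<open>X\<close> and
  \<open>\<Lambda>\<close> its fundamental group, \<open>H\<^sup>2(X,\<int>)\<close> is the group of alternating integral forms on \<open>\<Lambda>\<close>,
  and a holomorphic line bundle on \<open>X\<close> is a quotient of the trivial bundle on \<open>\<complex>\<^sup>2\<close>, that is, it
  is given by a factor of automorphy. The conventions are those of Birkenhake and Lange,
  Complex Abelian Varieties, Chapters 2--4.
\<close>

type_synonym C2 = "complex \<times> complex"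

definition lattice_basis :: "C2 set \<Rightarrow> C2 \<Rightarrow> C2 \<Rightarrow> C2 \<Rightarrow> C2 \<Rightarrow> bool" where
  "lattice_basis \<Lambda> b1 b2 b3 b4 \<longleftrightarrow>
     (\<forall>r1 r2 r3 r4 :: real. r1 *\<^sub>R b1 + r2 *\<^sub>R b2 + r3 *\<^sub>R b3 + r4 *\<^sub>R b4 = 0 \<longrightarrow>
        r1 = 0 \<and> r2 = 0 \<and> r3 = 0 \<and> r4 = 0) \<and>
     \<Lambda> = {of_int n1 *\<^sub>R b1 + of_int n2 *\<^sub>R b2 + of_int n3 *\<^sub>R b3 + of_int n4 *\<^sub>R b4 | n1 n2 n3 n4. True}"

definition is_lattice :: "C2 set \<Rightarrow> bool" where
  "is_lattice \<Lambda> \<longleftrightarrow> (\<exists>b1 b2 b3 b4. lattice_basis \<Lambda> b1 b2 b3 b4)"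

definition mult_i :: "C2 \<Rightarrow> C2" where
  "mult_i v = (\<i> * fst v, \<i> * snd v)"


subsection \<open>Second cohomology and the intersection form\<close>

type_synonym form = "C2 \<Rightarrow> C2 \<Rightarrow> real"

text \<open>An integral alternating form on \<open>\<Lambda>\<close> is represented by its unique \<open>\<real>\<close>-bilinear extension
  to \<open>\<complex>\<^sup>2\<close>, so that equality and addition of classes are those of functions.\<close>

definition H2 :: "C2 set \<Rightarrow> form set" where
  "H2 \<Lambda> = {E. bilinear E \<and> (\<forall>v. E v v = 0) \<and> (\<forall>l\<in>\<Lambda>. \<forall>m\<in>\<Lambda>. E l m \<in> \<int>)}"

definition wedge :: "form \<Rightarrow> form \<Rightarrow> C2 \<Rightarrow> C2 \<Rightarrow> C2 \<Rightarrow> C2 \<Rightarrow> real" where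
  "wedge E F v1 v2 v3 v4 =
     E v1 v2 * F v3 v4 - E v1 v3 * F v2 v4 + E v1 v4 * F v2 v3
   + E v2 v3 * F v1 v4 - E v2 v4 * F v1 v3 + E v3 v4 * F v1 v2"

text \<open>The volume form \<open>dx\<^sub>1 \<and> dy\<^sub>1 \<and> dx\<^sub>2 \<and> dy\<^sub>2\<close> of the complex orientation.\<close>

definition volume :: "C2 \<Rightarrow> C2 \<Rightarrow> C2 \<Rightarrow> C2 \<Rightarrow> real" where
  "volume = wedge (\<lambda>v w. Re (fst v) * Im (fst w) - Im (fst v) * Re (fst w))
                  (\<lambda>v w. Re (snd v) * Im (snd w) - Im (snd v) * Re (snd w))"

text \<open>The cup product \<open>H\<^sup>2 \<times> H\<^sup>2 \<rightarrow> H\<^sup>4 = \<int>\<close>: the value of \<open>E \<and> F\<close> on a positively oriented basis of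
  \<open>\<Lambda>\<close>; the sign makes the expression independent of the basis.\<close>

definition intersection :: "C2 set \<Rightarrow> form \<Rightarrow> form \<Rightarrow> int" where
  "intersection \<Lambda> E F = (THE m. \<forall>b1 b2 b3 b4. lattice_basis \<Lambda> b1 b2 b3 b4 \<longrightarrow>
     of_int m = sgn (volume b1 b2 b3 b4) * wedge E F b1 b2 b3 b4)"


subsection \<open>Line bundles, Chern classes and the Neron--Severi lattice\<close>

definition holomorphic_C2 :: "(C2 \<Rightarrow> complex) \<Rightarrow> bool" where
  "holomorphic_C2 g \<longleftrightarrow>
     (\<forall>v. \<exists>a b. (g has_derivative (\<lambda>h. a * fst h + b * snd h)) (at v))"

text \<open>The line bundle of \<open>e\<close> is the quotient of \<open>\<complex>\<^sup>2 \<times> \<complex>\<close> by \<open>l \<cdot> (v, t) = (v + l, e l v * t)\<close>.\<close>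

definition factor_of_automorphy :: "C2 set \<Rightarrow> (C2 \<Rightarrow> C2 \<Rightarrow> complex) \<Rightarrow> bool" where
  "factor_of_automorphy \<Lambda> e \<longleftrightarrow>
     (\<forall>l\<in>\<Lambda>. holomorphic_C2 (e l) \<and> (\<forall>v. e l v \<noteq> 0)) \<and>
     (\<forall>l\<in>\<Lambda>. \<forall>m\<in>\<Lambda>. \<forall>v. e (l + m) v = e m (v + l) * e l v)"

text \<open>The first Chern class is the image under the connecting map \<open>H\<^sup>1(X,\<O>\<^sup>*) \<rightarrow> H\<^sup>2(X,\<int>)\<close> of the
  exponential sequence: choose holomorphic logarithms \<open>e l = exp (2\<pi>i f l)\<close>, take the integral
  2-cocycle \<open>(l, m) \<mapsto> f m (v + l) - f (l + m) v + f l v\<close> and antisymmetrize it. The result does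
  not depend on \<open>v\<close> or on the choice of the logarithms.\<close>

definition chern_class :: "C2 set \<Rightarrow> (C2 \<Rightarrow> C2 \<Rightarrow> complex) \<Rightarrow> form \<Rightarrow> bool" where
  "chern_class \<Lambda> e E \<longleftrightarrow> E \<in> H2 \<Lambda> \<and>
     (\<exists>f. (\<forall>l\<in>\<Lambda>. holomorphic_C2 (f l) \<and> (\<forall>v. e l v = exp (2 * of_real pi * \<i> * f l v))) \<and>
          (\<forall>l\<in>\<Lambda>. \<forall>m\<in>\<Lambda>. \<forall>v.
             of_real (E l m) = f m (v + l) + f l v - f l (v + m) - f m v))"

definition NS :: "C2 set \<Rightarrow> form set" where
  "NS \<Lambda> = {E. \<exists>e. factor_of_automorphy \<Lambda> e \<and> chern_class \<Lambda> e E}"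


subsection \<open>Polarizations\<close>

text \<open>A polarization is the first Chern class of a positive definite line bundle: the Hermitian
  form \<open>H v w = E (\<i> v) w + \<i> E v w\<close> attached to \<open>E\<close> is positive definite.\<close>

definition polarization :: "C2 set \<Rightarrow> form \<Rightarrow> bool" where
  "polarization \<Lambda> L \<longleftrightarrow> L \<in> NS \<Lambda> \<and> (\<forall>v. v \<noteq> 0 \<longrightarrow> L (mult_i v) v > 0)"

text \<open>Principal means of type \<open>(1,1)\<close>: \<open>L\<close> has a symplectic basis with elementary divisors 1.\<close>

definition principal_polarization :: "C2 set \<Rightarrow> form \<Rightarrow> bool" where
  "principal_polarization \<Lambda> L \<longleftrightarrow> polarization \<Lambda> L \<and>
     (\<exists>b1 b2 b3 b4. lattice_basis \<Lambda> b1 b2 b3 b4 \<and>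
        L b1 b3 = 1 \<and> L b2 b4 = 1 \<and>
        L b1 b2 = 0 \<and> L b1 b4 = 0 \<and> L b2 b3 = 0 \<and> L b3 b4 = 0)"

definition abelian_surface :: "C2 set \<Rightarrow> bool" where
  "abelian_surface \<Lambda> \<longleftrightarrow> is_lattice \<Lambda> \<and> (\<exists>L. polarization \<Lambda> L)"


subsection \<open>Picard number and discriminant\<close>

definition int_comb :: "(nat \<Rightarrow> int) \<Rightarrow> form list \<Rightarrow> form" where
  "int_comb c Bs = (\<lambda>v w. \<Sum>k<length Bs. of_int (c k) * (Bs ! k) v w)"

definition int_basis :: "form set \<Rightarrow> form list \<Rightarrow> bool" where
  "int_basis A Bs \<longleftrightarrow>
     A = range (\<lambda>c. int_comb c Bs) \<and>
     (\<forall>c. int_comb c Bs = 0 \<longrightarrow> (\<forall>k<length Bs. c k = 0))"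

definition gram_matrix :: "C2 set \<Rightarrow> form list \<Rightarrow> int mat" where
  "gram_matrix \<Lambda> Bs =
     mat (length Bs) (length Bs) (\<lambda>(j, k). intersection \<Lambda> (Bs ! j) (Bs ! k))"

text \<open>The rank and the Gram determinant do not depend on the basis chosen here.\<close>

definition NS_basis :: "C2 set \<Rightarrow> form list" where
  "NS_basis \<Lambda> = (SOME Bs. int_basis (NS \<Lambda>) Bs)"

definition picard_number :: "C2 set \<Rightarrow> nat" where
  "picard_number \<Lambda> = length (NS_basis \<Lambda>)"

definition NS_discriminant :: "C2 set \<Rightarrow> int" where
  "NS_discriminant \<Lambda> = Determinant.det (gram_matrix \<Lambda> (NS_basis \<Lambda>))"


subsection \<open>Transcendental lattice, Mukai lattice and self-mirror surfaces\<close>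

definition transcendental :: "C2 set \<Rightarrow> form set" where
  "transcendental \<Lambda> = {F \<in> H2 \<Lambda>. \<forall>E \<in> NS \<Lambda>. intersection \<Lambda> F E = 0}"

definition mukai_lattice :: "C2 set \<Rightarrow> (int \<times> form \<times> int) set" where
  "mukai_lattice \<Lambda> = UNIV \<times> NS \<Lambda> \<times> UNIV"

fun mukai_pairing :: "C2 set \<Rightarrow> int \<times> form \<times> int \<Rightarrow> int \<times> form \<times> int \<Rightarrow> int" where
  "mukai_pairing \<Lambda> (r, D, s) (r', D', s') = intersection \<Lambda> D D' - r * s' - s * r'"

definition lattice_isometry ::
  "'a::ab_group_add set \<Rightarrow> ('a \<Rightarrow> 'a \<Rightarrow> int) \<Rightarrow> 'b::ab_group_add set \<Rightarrow> ('b \<Rightarrow> 'b \<Rightarrow> int) \<Rightarrow>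
   ('a \<Rightarrow> 'b) \<Rightarrow> bool" where
  "lattice_isometry A p B q \<phi> \<longleftrightarrow> bij_betw \<phi> A B \<and>
     (\<forall>x\<in>A. \<forall>y\<in>A. \<phi> (x + y) = \<phi> x + \<phi> y) \<and>
     (\<forall>x\<in>A. \<forall>y\<in>A. q (\<phi> x) (\<phi> y) = p x y)"

definition self_mirror :: "C2 set \<Rightarrow> bool" where
  "self_mirror \<Lambda> \<longleftrightarrow> (\<exists>\<phi>. lattice_isometry
     (transcendental \<Lambda>) (intersection \<Lambda>) (mukai_lattice \<Lambda>) (mukai_pairing \<Lambda>) \<phi>)"

end

(*
  The Neron-Severi lattice consists of the classes E with E (i v) (i w) = E v w: the Appell-Humbert
  factors realize all of them, and Stokes' theorem on the faces of a period parallelepiped shows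
  that E wedge dz1 wedge dz2 vanishes for every Chern class E.  The principal polarization L has square 2
  and extends to a basis L, M of NS; write D > 0 for minus the discriminant (Hodge index theorem) and
  q = k^2 + b k m - c m^2, b^2 + 4 c = D, for half the form on NS.  Then half the form on N is U + q, and
  since NS is primitive, half the form on T is U - q.

  So X is self-mirror iff U + q is isometric to its negative.  Given such an isometry, the image of
  the vector (0, 0, -b, 2), which pairs to multiples of D with the whole lattice, yields m with
  D dividing m^2 + 4, which excludes 16 and the primes 3 mod 4.  Conversely the condition on D
  gives D = a^2 + 4 s^2 with a, s coprime, so that q may be taken to be k^2 + a k m - s^2 m^2, and then the
  negated form has the isotropic vector (s, -s, 0, 1), from which the isometry is written down.
*)
theory Submission
  imports Defs "HOL-Complex_Analysis.Cauchy_Integral_Formula" "HOL-Number_Theory.Euler_Criterion"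
begin

text \<open>The isometry class of T must be found although M is known only through primitivity and
  D. In H^2, a sum of three hyperbolic planes, the complement of L is (-2) + U + U, and T is the
  complement in it of a class with coefficients \<open>\<beta>\<close>, P, Q, R, S. The Eichler
  principle applies: with a hyperbolic plane to spare, such primitive data are determined up to
  isometry by D. It is proved by a Euclidean descent with explicit transvections.

  Hence b and c are free subject to b^2 + 4 c = D. The converse lives on this freedom: D = a^2 + 4
  s^2 allows b = a and the square c = s^2, which creates an isotropic vector, and coprimality of a
  and s lets that vector split off a hyperbolic plane.

  The vector (0, 0, -b, 2) is D times the element of the dual lattice that reads off the coordinate
  m up to sign; this explains its divisibility.

  On the analytic side, holomorphy is only the existence of a complex derivative at each point, so
  the continuity of the gradient needed for the averaging in Stokes' theorem has to be extracted
  from Cauchy's formula.\<close>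

subsection \<open>Sums of two squares\<close>

text \<open>Meant for the smaller of m and m' when m m' = k^2 + 1: it makes each reduction step
  below strictly lower the absolute value of k.\<close>

lemma le_abs_if_square_le:
  fixes x k :: int
  assumes "x * x \<le> k\<^sup>2 + 1" "k \<noteq> 0"
  shows "x \<le> \<bar>k\<bar>"
proof (rule ccontr)
  assume "\<not> ?thesis"
  then have "(\<bar>k\<bar> + 1) * (\<bar>k\<bar> + 1) \<le> x * x" by (intro mult_mono) auto
  moreover have "(\<bar>k\<bar> + 1) * (\<bar>k\<bar> + 1) = k\<^sup>2 + 2 * \<bar>k\<bar> + 1"
    by (simp add: power2_eq_square algebra_simps)
  ultimately show False using assms by linarith
qed

text \<open>The form m x^2 + 2 k x y + m' y^2 is positive of determinant 1, and the descent on k is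
  its Gauss reduction to x^2 + y^2. The vectors (a, b) and (c, d) realise it as a Gram matrix; the
  determinant 1 of their matrix later gives coprimality.\<close>

lemma sum_two_squares_form:
  fixes m m' k :: int
  assumes "m * m' = k\<^sup>2 + 1" "m > 0"
  shows "\<exists>a b c d. m = a\<^sup>2 + b\<^sup>2 \<and> m' = c\<^sup>2 + d\<^sup>2 \<and> k = a * c + b * d \<and> a * d - b * c = 1"
  using assms
proof (induction "nat \<bar>k\<bar>" arbitrary: k m m' rule: less_induct)
  case less
  have m': "m' > 0"
    using less.prems by (smt (verit) zero_less_mult_pos zero_le_power2)
  show ?case
  proof (cases "k = 0")
    case True
    then have "m = 1" "m' = 1" using less.prems m' by (auto simp: pos_zmult_eq_1_iff)
    then show ?thesis using True
      by (intro exI[of _ 1] exI[of _ 0] exI[of _ 0] exI[of _ 1]) auto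
  next
    case False
    \<comment> \<open>Subtracting \<sigma> times the smaller diagonal entry shortens k. On vectors
      this is a shear, undone at the end by adding \<sigma> (a, b) to (c, d) or vice versa.\<close>
    define \<sigma> where "\<sigma> = sgn k"
    have \<sigma>: "\<sigma> * \<sigma> = 1" "\<sigma> * k = \<bar>k\<bar>" using False by (auto simp: \<sigma>_def sgn_if)
    have red: "\<bar>k - \<sigma> * x\<bar> < \<bar>k\<bar>" if "0 < x" "x \<le> \<bar>k\<bar>" for x
      using that False by (auto simp: \<sigma>_def sgn_if)
    show ?thesis
    proof (cases "m \<le> m'")
      case True
      have "m * m \<le> k\<^sup>2 + 1" using True less.prems by (metis mult_left_mono order_less_imp_le)
      then have le: "m \<le> \<bar>k\<bar>" using False by (rule le_abs_if_square_le)
      have eq: "m * (m' - 2 * \<sigma> * k + m) = (k - \<sigma> * m)\<^sup>2 + 1"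
        using less.prems(1) \<sigma>(1) by (simp add: power2_eq_square algebra_simps)
      have "nat \<bar>k - \<sigma> * m\<bar> < nat \<bar>k\<bar>" using red[OF less.prems(2) le] by simp
      from less.hyps[OF this eq less.prems(2)] obtain a b c d where
        h: "m = a\<^sup>2 + b\<^sup>2" "m' - 2 * \<sigma> * k + m = c\<^sup>2 + d\<^sup>2" "k - \<sigma> * m = a * c + b * d" "a * d - b * c = 1"
        by blast
      have k: "k = a * c + b * d + \<sigma> * m" using h(3) by simp
      have "m' = (c + \<sigma> * a)\<^sup>2 + (d + \<sigma> * b)\<^sup>2"
      proof -
        have "m' = c\<^sup>2 + d\<^sup>2 + 2 * \<sigma> * (a * c + b * d) + (2 * (\<sigma> * \<sigma>) - 1) * m"
          using h(2) k by (simp add: algebra_simps)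
        also have "\<dots> = c\<^sup>2 + d\<^sup>2 + 2 * \<sigma> * (a * c + b * d) + (\<sigma> * \<sigma>) * (a\<^sup>2 + b\<^sup>2)"
          using \<sigma> h(1) by simp
        also have "\<dots> = (c + \<sigma> * a)\<^sup>2 + (d + \<sigma> * b)\<^sup>2" by (simp add: power2_eq_square algebra_simps)
        finally show ?thesis .
      qed
      moreover have "k = a * (c + \<sigma> * a) + b * (d + \<sigma> * b)"
        using k h(1) by (simp add: power2_eq_square algebra_simps)
      moreover have "a * (d + \<sigma> * b) - b * (c + \<sigma> * a) = 1" using h(4) by (simp add: algebra_simps)
      ultimately show ?thesis using h(1) by blast
    next
      case m_gt: False
      have "m' * m' \<le> k\<^sup>2 + 1" using m_gt less.prems m' by (metis mult_right_mono order_less_imp_le linorder_not_le)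
      then have le: "m' \<le> \<bar>k\<bar>" using False by (rule le_abs_if_square_le)
      have eq: "(m - 2 * \<sigma> * k + m') * m' = (k - \<sigma> * m')\<^sup>2 + 1"
        using less.prems(1) \<sigma>(1) by (simp add: power2_eq_square algebra_simps)
      have pos: "m - 2 * \<sigma> * k + m' > 0" using eq m'
        by (smt (verit) zero_less_mult_pos2 zero_le_power2)
      have "nat \<bar>k - \<sigma> * m'\<bar> < nat \<bar>k\<bar>" using red[OF m' le] by simp
      from less.hyps[OF this eq pos] obtain a b c d where
        h: "m - 2 * \<sigma> * k + m' = a\<^sup>2 + b\<^sup>2" "m' = c\<^sup>2 + d\<^sup>2" "k - \<sigma> * m' = a * c + b * d" "a * d - b * c = 1"
        by blast
      have k: "k = a * c + b * d + \<sigma> * m'" using h(3) by simp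
      have "m = (a + \<sigma> * c)\<^sup>2 + (b + \<sigma> * d)\<^sup>2"
      proof -
        have "m = a\<^sup>2 + b\<^sup>2 + 2 * \<sigma> * (a * c + b * d) + (2 * (\<sigma> * \<sigma>) - 1) * m'"
          using h(1) k by (simp add: algebra_simps)
        also have "\<dots> = a\<^sup>2 + b\<^sup>2 + 2 * \<sigma> * (a * c + b * d) + (\<sigma> * \<sigma>) * (c\<^sup>2 + d\<^sup>2)"
          using \<sigma> h(2) by simp
        also have "\<dots> = (a + \<sigma> * c)\<^sup>2 + (b + \<sigma> * d)\<^sup>2" by (simp add: power2_eq_square algebra_simps)
        finally show ?thesis .
      qed
      moreover have "k = (a + \<sigma> * c) * c + (b + \<sigma> * d) * d"
        using k h(2) by (simp add: power2_eq_square algebra_simps)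
      moreover have "(a + \<sigma> * c) * d - (b + \<sigma> * d) * c = 1" using h(4) by (simp add: algebra_simps)
      ultimately show ?thesis using h(2) by blast
    qed
  qed
qed

lemma minus_one_QuadRes:
  fixes p :: nat
  assumes "prime p" "[p = 1] (mod 4)"
  shows "\<exists>k. int p dvd k\<^sup>2 + 1"
proof -
  have "p \<noteq> 2" using assms(2) by (auto simp: cong_def)
  then have p2: "2 < p" using prime_ge_2_nat[OF assms(1)] by simp
  obtain j where "p = 4 * j + 1"
    using assms(2) p2 by (metis cong_def div_mod_decomp mult.commute mod_less one_less_numeral_iff semiring_norm(76))
  then have "even ((p - 1) div 2)" by simp
  then have "[Legendre (-1) p = 1] (mod p)"
    using euler_criterion[OF assms(1) p2, of "-1"] by simp
  then have "Legendre (-1) p = 1"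
    using p2 by (auto simp: Legendre_def cong_iff_dvd_diff split: if_splits dest: zdvd_imp_le)
  then have "QuadRes p (-1)" by (auto simp: Legendre_def split: if_splits)
  then show ?thesis by (auto simp: QuadRes_def cong_iff_dvd_diff)
qed

text \<open>If p divides m, the root is lifted as in Hensel's lemma; otherwise the Chinese remainder
  theorem combines k with a root modulo p.\<close>

lemma sqrt_minus_one_mod_mult_prime:
  fixes m :: int and p :: nat
  assumes k: "m dvd k\<^sup>2 + 1" and p: "prime p" "[p = 1] (mod 4)"
  shows "\<exists>k. int p * m dvd k\<^sup>2 + 1"
proof (cases "int p dvd m")
  case True
  have pp: "prime (int p)" using p by simp
  from k obtain t where t: "k\<^sup>2 + 1 = m * t" by auto
  have "\<not> int p dvd 2"
  proof
    assume "int p dvd 2"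
    then have "p \<le> 2" by (auto dest: zdvd_imp_le)
    then have "p = 2" using p prime_ge_2_nat by (simp add: order_antisym)
    then show False using p(2) by (simp add: cong_def)
  qed
  moreover have "\<not> int p dvd k"
  proof
    assume "int p dvd k"
    then have "int p dvd 1" using True t
      by (metis dvd_add_right_iff dvd_mult dvd_mult2 power2_eq_square)
    then show False using pp by (simp add: prime_int_iff)
  qed
  ultimately have "coprime (2 * k) (int p)"
    using pp by (metis coprime_commute prime_dvd_mult_iff prime_imp_coprime)
  then obtain z where z: "[2 * k * z = 1] (mod int p)" by (metis cong_solve_coprime_int)
  \<comment> \<open>With k^2 + 1 = m t, squaring k + m s leaves the condition t + 2 k s = 0 modulo
    p, solvable because 2 k is a unit there.\<close>
  define s where "s = - z * t"
  have "int p dvd t + 2 * k * s"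
  proof -
    have "t + 2 * k * s = (2 * k * z - 1) * (- t)" by (simp add: s_def algebra_simps)
    moreover have "int p dvd 2 * k * z - 1" using z by (simp add: cong_iff_dvd_diff)
    ultimately show ?thesis by (metis dvd_mult2)
  qed
  then have "int p dvd t + 2 * k * s + m * s\<^sup>2" using True by simp
  then have "m * int p dvd m * (t + 2 * k * s + m * s\<^sup>2)" by (rule mult_dvd_mono[OF dvd_refl])
  also have "m * (t + 2 * k * s + m * s\<^sup>2) = (k + m * s)\<^sup>2 + 1"
    using t by (simp add: power2_eq_square algebra_simps)
  finally show ?thesis by (metis mult.commute)
next
  case False
  obtain j where j: "int p dvd j\<^sup>2 + 1" using minus_one_QuadRes[OF p] by auto
  have cop: "coprime (int p) m" using False p by (simp add: prime_imp_coprime)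
  then obtain x where x: "[x = j] (mod int p)" "[x = k] (mod m)"
    using binary_chinese_remainder_int by blast
  have "int p dvd x\<^sup>2 + 1"
    using x(1) j by (metis cong_add_rcancel cong_dvd_iff cong_pow)
  moreover have "m dvd x\<^sup>2 + 1"
    using x(2) k by (metis cong_add_rcancel cong_dvd_iff cong_pow)
  ultimately show ?thesis using cop divides_mult by blast
qed

text \<open>Prime factors are split off one at a time. The prime 2 occurs at most once; there the
  root modulo the odd cofactor is made odd, if necessary by adding that cofactor.\<close>

lemma sqrt_minus_one_mod:
  fixes n :: nat
  assumes "n > 0" "\<not> 4 dvd n" "\<And>p. prime p \<Longrightarrow> [p = 3] (mod 4) \<Longrightarrow> \<not> p dvd n"
  shows "\<exists>k. int n dvd k\<^sup>2 + 1"
  using assms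
proof (induction n rule: less_induct)
  case (less n)
  show ?case
  proof (cases "n = 1")
    case False
    then obtain p where p: "prime p" "p dvd n" using prime_factor_nat by blast
    then obtain m where m: "n = p * m" by auto
    have "m < n" "m > 0" using m p less.prems(1) prime_gt_1_nat by auto
    moreover have "\<not> 4 dvd m" using less.prems(2) m by auto
    moreover have "\<not> q dvd m" if "prime q" "[q = 3] (mod 4)" for q
      using less.prems(3)[OF that] m by auto
    ultimately obtain k where k: "int m dvd k\<^sup>2 + 1" using less.IH by blast
    show ?thesis
    proof (cases "p = 2")
      case True
      have odd: "odd m" using less.prems(2) m True by auto
      then obtain j where j: "int m dvd j\<^sup>2 + 1" "odd j"
      proof (cases "odd k")
        case False
        have "int m dvd (k + int m)\<^sup>2 + 1"
        proof -
          have "(k + int m)\<^sup>2 + 1 = (k\<^sup>2 + 1) + int m * (2 * k + int m)"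
            by (simp add: power2_eq_square algebra_simps)
          then show ?thesis using k by (metis dvd_add dvd_triv_left)
        qed
        then show ?thesis using that odd False by auto
      qed (use k in blast)
      have "coprime (2::int) (int m)" using odd by simp
      moreover have "2 dvd j\<^sup>2 + 1" using j(2) by simp
      ultimately have "2 * int m dvd j\<^sup>2 + 1" using j(1) divides_mult by blast
      then show ?thesis using m True by auto
    next
      case False
      then have "odd p" using p(1) primes_dvd_imp_eq two_is_prime_nat by blast
      then have "p mod 4 = 1 \<or> p mod 4 = 3" by presburger
      then have "[p = 1] (mod 4)" using less.prems(3)[OF p(1)] p(2) by (auto simp: cong_def)
      then show ?thesis using sqrt_minus_one_mod_mult_prime[OF k p(1)] m by simp
    qed
  qed auto
qed

lemma coprime_sum_two_squares:
  fixes n :: nat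
  assumes "n > 0" "\<not> 4 dvd n" "\<And>p. prime p \<Longrightarrow> [p = 3] (mod 4) \<Longrightarrow> \<not> p dvd n"
  obtains a b :: int where "int n = a\<^sup>2 + b\<^sup>2" "coprime a b"
proof -
  obtain k where "int n dvd k\<^sup>2 + 1" using sqrt_minus_one_mod[OF assms] by blast
  then obtain m' where "int n * m' = k\<^sup>2 + 1" by (metis dvdE)
  from sum_two_squares_form[OF this] assms(1) obtain a b c d where
    "int n = a\<^sup>2 + b\<^sup>2" "a * d - b * c = 1" by auto
  moreover from this have "coprime a b"
    by (intro coprimeI) (metis dvd_diff dvd_mult2)
  ultimately show ?thesis using that by blast
qed

text \<open>For even D, D / 4 is a sum of two coprime squares, and an odd one of the two roots
  becomes s, so that twice the other stays coprime to it. For odd D the even root is 2 s.\<close>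

lemma sum_square_four_squares:
  fixes D :: int
  assumes D: "D > 0" "D mod 4 = 0 \<or> D mod 4 = 1" "\<not> 16 dvd D"
    and pr: "\<And>p::nat. prime p \<Longrightarrow> [p = 3] (mod 4) \<Longrightarrow> \<not> int p dvd D"
  shows "\<exists>a s :: int. D = a\<^sup>2 + 4 * s\<^sup>2 \<and> coprime a s"
proof (cases "even D")
  case True
  define n where "n = nat (D div 4)"
  have n: "D = 4 * int n" using D True by (auto simp: n_def) presburger
  have "n > 0" "\<not> 4 dvd n" 
    using n D(1) apply simp
    using n D(3) by (auto elim!: dvdE)
  moreover have "\<not> p dvd n" if "prime p" "[p = 3] (mod 4)" for p
    using pr[OF that] n by auto
  ultimately obtain a b :: int where ab: "int n = a\<^sup>2 + b\<^sup>2" "coprime a b"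
    using coprime_sum_two_squares by blast
  have main: ?thesis if "int n = a\<^sup>2 + b\<^sup>2" "coprime a b" "odd b" for a b :: int
  proof -
    have "D = (2 * a)\<^sup>2 + 4 * b\<^sup>2" using n that by (simp add: power2_eq_square)
    moreover have "coprime (2 * a) b" using that by simp
    ultimately show ?thesis by blast
  qed
  show ?thesis
  proof (cases "odd b")
    case True then show ?thesis using main ab by blast
  next
    case False
    then have "odd a" using ab(2) by (meson coprime_common_divisor odd_one)
    then show ?thesis using main[of b a] ab by (simp add: coprime_commute add.commute)
  qed
next
  case False
  define n where "n = nat D"
  have n: "D = int n" using D by (simp add: n_def)
  have "n > 0" using n D by auto
  moreover have "\<not> 4 dvd n" using n False by (metis dvd_trans even_numeral even_of_nat)
  moreover have "\<not> p dvd n" if "prime p" "[p = 3] (mod 4)" for p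
    using pr[OF that] n by auto
  ultimately obtain a b :: int where ab: "int n = a\<^sup>2 + b\<^sup>2" "coprime a b"
    using coprime_sum_two_squares by blast
  have main: ?thesis if "int n = a\<^sup>2 + b\<^sup>2" "coprime a b" "even b" for a b :: int
  proof -
    from that obtain s where "b = 2 * s" by auto
    then have "D = a\<^sup>2 + 4 * s\<^sup>2" "coprime a s" using n that by auto
    then show ?thesis by blast
  qed
  show ?thesis
  proof (cases "even b")
    case True then show ?thesis using main ab by blast
  next
    case False
    then have "even a" using ab n \<open>odd D\<close> by auto
    then show ?thesis using main[of b a] ab by (simp add: coprime_commute add.commute)
  qed
qed

text \<open>Otherwise -4 and 4 are both squares modulo p. Their powers with the odd exponent (p - 1)
  / 2 are then both 1 by Euler's criterion, yet they sum to 0, so p would divide 2.\<close>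

lemma prime_3_mod_4_not_dvd:
  fixes p :: nat and m :: int
  assumes p: "prime p" "[p = 3] (mod 4)"
  shows "\<not> int p dvd m\<^sup>2 + 4"
proof
  assume dvd: "int p dvd m\<^sup>2 + 4"
  obtain j where j: "p = 4 * j + 3"
    using p(2) unfolding cong_def by (metis div_mod_decomp mod_less mult.commute numeral_less_iff
        semiring_norm(76) semiring_norm(78) semiring_norm(81))
  have p2: "2 < p" using j by simp
  have npd: "\<not> int p dvd 4"
  proof
    assume "int p dvd 4"
    then have "int p dvd 2 ^ 2" by simp
    moreover have "prime (int p)" using p(1) by simp
    ultimately have "int p dvd 2" by (rule prime_dvd_power[rotated])
    then show False using p2 by (auto dest: zdvd_imp_le)
  qed
  have hlf: "(p - 1) div 2 = 2 * j + 1" using j by simp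
  have "[m\<^sup>2 = -4] (mod int p)" using dvd by (simp add: cong_iff_dvd_diff)
  then have "QuadRes p (-4)" by (auto simp: QuadRes_def)
  then have "Legendre (-4) p = 1" using npd by (auto simp: Legendre_def cong_iff_dvd_diff)
  moreover have "QuadRes p 4" unfolding QuadRes_def by (rule exI[of _ 2]) simp
  then have "Legendre 4 p = 1" using npd by (auto simp: Legendre_def cong_iff_dvd_diff)
  ultimately have "[1 = (-4) ^ (2 * j + 1)] (mod int p)" "[1 = 4 ^ (2 * j + 1)] (mod int p)"
    using euler_criterion[OF p(1) p2, of "-4"] euler_criterion[OF p(1) p2, of 4]
    unfolding hlf by simp_all
  then have "[1 + 1 = (-4) ^ (2 * j + 1) + 4 ^ (2 * j + 1)] (mod int p)" by (rule cong_add)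
  then have "int p dvd 2" by (simp add: cong_iff_dvd_diff)
  then show False using p2 by (auto dest: zdvd_imp_le)
qed

subsection \<open>The quaternary forms\<close>

type_synonym int4 = "int \<times> int \<times> int \<times> int"
type_synonym int5 = "int \<times> int \<times> int \<times> int \<times> int"

fun hyp_form :: "int \<Rightarrow> int \<Rightarrow> int4 \<Rightarrow> int" where
  "hyp_form b c (u, v, k, m) = u * v + (k\<^sup>2 + b * k * m - c * m\<^sup>2)"

fun quint_form :: "int5 \<Rightarrow> int" where
  "quint_form (p, x, y, z, w) = p\<^sup>2 + x * y + z * w"

text \<open>Up to sign, \<open>quint_form\<close> is half the intersection form on the complement of \<open>L\<close> in \<open>H\<^sup>2\<close>, and
  \<open>quint_section\<close> is the orthogonal complement there of a class with symplectic coordinates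
  \<open>0, \<beta>\<close> (dual to \<open>p, -p\<close>) and \<open>P, Q, R, S\<close>, i.e. the transcendental lattice.\<close>

definition quint_section :: "int \<Rightarrow> int \<Rightarrow> int \<Rightarrow> int \<Rightarrow> int \<Rightarrow> int5 set" where
  "quint_section \<beta> P Q R S = {(p, x, y, z, w). \<beta> * p = Q * x + P * y + S * z + R * w}"

text \<open>The target of the descent: the complement cut out by the data is U + q, whatever the
  data are, once they are primitive and \<open>\<beta>\<^sup>2 + 4 * (P * Q + R * S)\<close> has the
  right value.\<close>

definition hyp_split :: "int \<Rightarrow> int \<Rightarrow> int \<Rightarrow> int \<Rightarrow> int \<Rightarrow> int \<Rightarrow> int \<Rightarrow> bool" where
  "hyp_split b c \<beta> P Q R S \<longleftrightarrow> (\<exists>\<phi>. bij_betw \<phi> UNIV (quint_section \<beta> P Q R S) \<and>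
     (\<forall>X Y. \<phi> (X + Y) = \<phi> X + \<phi> Y) \<and> (\<forall>X. quint_form (\<phi> X) = hyp_form b c X))"

text \<open>An automorphism f of the quinary form carries one section onto the other. As f acts on
  vectors, the data change by its transpose; all moves of the descent are instances.\<close>

lemma hyp_split_transfer:
  assumes "hyp_split b c \<beta>' P' Q' R' S'"
    and f: "\<And>X Y. f (X + Y) = f X + f Y" "\<And>X. quint_form (f X) = quint_form X"
    and gf: "\<And>X. g (f X) = X" and fg: "\<And>X. f (g X) = X"
    and iff: "\<And>X. f X \<in> quint_section \<beta> P Q R S \<longleftrightarrow> X \<in> quint_section \<beta>' P' Q' R' S'"
  shows "hyp_split b c \<beta> P Q R S"
proof -
  from assms(1) obtain \<phi> where \<phi>: "bij_betw \<phi> UNIV (quint_section \<beta>' P' Q' R' S')"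
    "\<And>X Y. \<phi> (X + Y) = \<phi> X + \<phi> Y" "\<And>X. quint_form (\<phi> X) = hyp_form b c X"
    unfolding hyp_split_def by blast
  have "bij_betw f (quint_section \<beta>' P' Q' R' S') (quint_section \<beta> P Q R S)"
    by (rule bij_betwI[of _ _ _ g]) (use iff gf fg in \<open>auto, metis\<close>)
  then have "bij_betw (f \<circ> \<phi>) UNIV (quint_section \<beta> P Q R S)"
    using \<phi>(1) bij_betw_trans by blast
  then show ?thesis
    unfolding hyp_split_def using \<phi> f by (intro exI[of _ "f \<circ> \<phi>"]) simp
qed

lemma hyp_split_swap_PQ: "hyp_split b c \<beta> Q P R S \<Longrightarrow> hyp_split b c \<beta> P Q R S"
  by (erule hyp_split_transfer[where f = "\<lambda>(p, x, y, z, w). (p, y, x, z, w)"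
      and g = "\<lambda>(p, x, y, z, w). (p, y, x, z, w)"])
    (auto simp: quint_section_def algebra_simps)

lemma hyp_split_swap_RS: "hyp_split b c \<beta> P Q S R \<Longrightarrow> hyp_split b c \<beta> P Q R S"
  by (erule hyp_split_transfer[where f = "\<lambda>(p, x, y, z, w). (p, x, y, w, z)"
      and g = "\<lambda>(p, x, y, z, w). (p, x, y, w, z)"])
    (auto simp: quint_section_def algebra_simps)

lemma hyp_split_swap_pairs: "hyp_split b c \<beta> R S P Q \<Longrightarrow> hyp_split b c \<beta> P Q R S"
  by (erule hyp_split_transfer[where f = "\<lambda>(p, x, y, z, w). (p, z, w, x, y)"
      and g = "\<lambda>(p, x, y, z, w). (p, z, w, x, y)"])
    (auto simp: quint_section_def algebra_simps)

text \<open>A transvection of the two hyperbolic planes: t y z enters \<open>x * y\<close> and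
  \<open>z * w\<close> with opposite signs.\<close>

lemma hyp_split_shear:
  "hyp_split b c \<beta> (P - t * R) Q R (S + t * Q) \<Longrightarrow> hyp_split b c \<beta> P Q R S"
  by (erule hyp_split_transfer[where f = "\<lambda>(p, x, y, z, w). (p, x + t * z, y, z, w - t * y)"
      and g = "\<lambda>(p, x, y, z, w). (p, x - t * z, y, z, w + t * y)"])
    (auto simp: quint_section_def algebra_simps)

lemma hyp_split_shear':
  "hyp_split b c \<beta> P (Q - t * R) R (S + t * P) \<Longrightarrow> hyp_split b c \<beta> P Q R S"
  by (rule hyp_split_swap_PQ, rule hyp_split_shear[where t = t], rule hyp_split_swap_PQ)

text \<open>The transvection that involves p. For R = 0 its only effect on the data is to add - t
  \<open>\<beta>\<close> to S, which is how \<open>\<beta>\<close> enters the descent.\<close>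

lemma hyp_split_eichler:
  "hyp_split b c (\<beta> + 2 * t * R) P Q R (S - t * \<beta> - t\<^sup>2 * R) \<Longrightarrow> hyp_split b c \<beta> P Q R S"
  by (erule hyp_split_transfer[
      where f = "\<lambda>(p, x, y, z, w). (p + t * z, x, y, z, w - 2 * t * p - t\<^sup>2 * z)"
      and g = "\<lambda>(p, x, y, z, w). (p - t * z, x, y, z, w + 2 * t * p - t\<^sup>2 * z)"])
    (auto simp: quint_section_def algebra_simps power2_eq_square)

text \<open>As P is a unit, y can be solved for, and z w plus a binary form with middle coefficient
  \<open>\<beta>\<close> remains. \<open>\<beta>\<close> and b have the same parity, so a shift of p
  by h m turns this coefficient into b; writing x = P m absorbs the sign of P.\<close>

lemma hyp_split_normal_form:
  assumes "\<beta>\<^sup>2 + 4 * (P * Q) = b\<^sup>2 + 4 * c" "P = 1 \<or> P = -1"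
  shows "hyp_split b c \<beta> P Q 0 0"
proof -
  have PP: "P * P = 1" using assms(2) by auto
  have "\<beta>\<^sup>2 = b\<^sup>2 + 2 * (2 * c - 2 * (P * Q))" using assms(1) by simp
  then have "even (\<beta>\<^sup>2) = even (b\<^sup>2)" by simp
  then have "even (\<beta> - b)" by simp
  then obtain h where h: "\<beta> = b + 2 * h" by (metis add_diff_cancel_left' dvdE diff_add_cancel add.commute)
  have c: "c = h\<^sup>2 + b * h + P * Q" using assms(1) h by (simp add: power2_eq_square algebra_simps)
  define f :: "int4 \<Rightarrow> int5" where
    "f = (\<lambda>(u, v, k, m). (k - h * m, P * m, P * (\<beta> * (k - h * m) - Q * (P * m)), u, v))"
  define g :: "int5 \<Rightarrow> int4" where "g = (\<lambda>(p, x, y, z, w). (z, w, p + h * (P * x), P * x))"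
  have PP': "P * (P * x) = x" for x by (simp add: PP flip: mult.assoc)
  have "bij_betw f UNIV (quint_section \<beta> P Q 0 0)"
  proof (rule bij_betwI[of _ _ _ g])
    show "f (g X) = X" if "X \<in> quint_section \<beta> P Q 0 0" for X
    proof (cases X)
      case (fields p x y z w)
      have "\<beta> * p - Q * x = P * y" using that unfolding fields quint_section_def by simp
      then show ?thesis unfolding fields f_def g_def by (simp add: PP')
    qed
  qed (auto simp: f_def g_def quint_section_def PP PP' algebra_simps)
  moreover have "quint_form (f X) = hyp_form b c X" for X
  proof (cases X)
    case (fields u v k m)
    have "P * m * (P * (\<beta> * (k - h * m) - Q * (P * m))) = P * P * (m * \<beta> * (k - h * m) - m * m * (P * Q))"
      by (simp add: algebra_simps)
    also have "\<dots> = m * \<beta> * (k - h * m) - m * m * (P * Q)" by (simp add: PP)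
    finally have "P * m * (P * (\<beta> * (k - h * m) - Q * (P * m))) = m * \<beta> * (k - h * m) - m * m * (P * Q)" .
    then show ?thesis unfolding c fields f_def h
      by (simp add: power2_eq_square algebra_simps)
  qed
  ultimately show ?thesis unfolding hyp_split_def
    by (intro exI[of _ f]) (auto simp: f_def algebra_simps)
qed

text \<open>Euclidean descent on \<open>\<bar>P\<bar>\<close> by the isometries above: if \<open>P\<close> is minimal in its orbit it divides
  every coordinate, hence is a unit.\<close>

lemma hyp_split_reduce:
  assumes "P \<noteq> 0" "\<And>k. k dvd \<beta> \<Longrightarrow> k dvd P \<Longrightarrow> k dvd Q \<Longrightarrow> k dvd R \<Longrightarrow> k dvd S \<Longrightarrow> k dvd 1"
    and "\<beta>\<^sup>2 + 4 * (P * Q + R * S) = b\<^sup>2 + 4 * c"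
  shows "hyp_split b c \<beta> P Q R S"
  using assms
proof (induction "nat \<bar>P\<bar>" arbitrary: \<beta> P Q R S rule: less_induct)
  case less
  let ?ok = "\<lambda>\<beta> P Q R S. (\<forall>k. k dvd \<beta> \<longrightarrow> k dvd P \<longrightarrow> k dvd Q \<longrightarrow> k dvd R \<longrightarrow> k dvd S \<longrightarrow> k dvd 1) \<and>
     \<beta>\<^sup>2 + 4 * (P * Q + R * S) = b\<^sup>2 + 4 * c"
  \<comment> \<open>A shear replaces S by its remainder modulo P, and exchanging the planes puts
    this smaller nonzero number in place of P.\<close>
  have S: "hyp_split b c \<beta> P Q R S" if "\<not> P dvd S" "?ok \<beta> P Q R S" for \<beta> Q R S
  proof -
    define t where "t = - (S div P)"
    have St: "S + t * P = S mod P" by (simp add: t_def minus_div_mult_eq_mod)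
    have "hyp_split b c \<beta> (S + t * P) R P (Q - t * R)"
    proof (rule less.hyps)
      show "nat \<bar>S + t * P\<bar> < nat \<bar>P\<bar>" unfolding St using less.prems(1) abs_mod_less by auto
      show "S + t * P \<noteq> 0" unfolding St using that(1) by (simp add: dvd_eq_mod_eq_0)
      show "\<beta>\<^sup>2 + 4 * ((S + t * P) * R + P * (Q - t * R)) = b\<^sup>2 + 4 * c"
        using that(2) by (simp add: algebra_simps)
      fix k assume k: "k dvd \<beta>" "k dvd S + t * P" "k dvd R" "k dvd P" "k dvd Q - t * R"
      then have "k dvd S" by (metis dvd_add_left_iff dvd_mult)
      moreover have "k dvd Q" using k by (metis dvd_diff_left_iff dvd_mult)
      ultimately show "k dvd 1" using that(2) k by blast
    qed
    then have "hyp_split b c \<beta> P (Q - t * R) R (S + t * P)"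
      by (rule hyp_split_swap_RS[OF hyp_split_swap_pairs])
    then show ?thesis by (rule hyp_split_shear')
  qed
  have R: "hyp_split b c \<beta> P Q R S" if "\<not> P dvd R" "?ok \<beta> P Q R S" for \<beta> Q R S
    by (rule hyp_split_swap_RS, rule S) (use that in \<open>auto simp: algebra_simps\<close>)
  show ?case
  proof (cases "P dvd R \<and> P dvd S")
    case False
    then show ?thesis using R S less.prems by blast
  next
    case True
    then obtain t u where t: "R = P * t" "S = P * u" by (metis dvdE)
    \<comment> \<open>As P divides R and S, two shears clear both; the product R S = P u R moves
      into Q, which keeps P Q + R S.\<close>
    define Q' where "Q' = Q + u * R"
    have "hyp_split b c \<beta> P Q' 0 0"
    proof -
      have ok: "?ok \<beta> P Q' 0 0"
      proof (intro conjI allI impI)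
        fix k assume k: "k dvd \<beta>" "k dvd P" "k dvd Q'"
        then have "k dvd R" "k dvd S" using t by auto
        moreover from this have "k dvd Q" using k(3) unfolding Q'_def
          by (metis dvd_add_left_iff dvd_mult)
        ultimately show "k dvd 1" using less.prems(2) k by blast
      next
        show "\<beta>\<^sup>2 + 4 * (P * Q' + 0 * 0) = b\<^sup>2 + 4 * c"
          using less.prems(3) t by (simp add: Q'_def algebra_simps)
      qed
      show ?thesis
      proof (cases "P dvd Q'")
        case False
        \<comment> \<open>With R = S = 0 a shear copies Q' into S without touching P, so the descent
          can continue from a remainder of Q'.\<close>
        have "hyp_split b c \<beta> (P - 1 * 0) Q' 0 (0 + 1 * Q')"
          unfolding mult_zero_right diff_zero
          by (rule S) (use False ok in auto)
        then show ?thesis by (rule hyp_split_shear)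
      next
        case Q: True
        show ?thesis
        proof (cases "P dvd \<beta>")
          case False
          have "hyp_split b c (\<beta> + 2 * 1 * 0) P Q' 0 (0 - 1 * \<beta> - 1\<^sup>2 * 0)"
            by (simp, rule S) (use False ok in auto)
          then show ?thesis by (rule hyp_split_eichler)
        next
          case True
          then have "P dvd 1" using ok Q by auto
          then have "P = 1 \<or> P = -1" by auto
          then show ?thesis using hyp_split_normal_form ok by auto
        qed
      qed
    qed
    have "hyp_split b c \<beta> P (Q - (- u) * R) R (S + (- u) * P)"
    proof (rule hyp_split_swap_RS)
      have "hyp_split b c \<beta> P (Q' - (- t) * 0) 0 (R + (- t) * P)"
        using \<open>hyp_split b c \<beta> P Q' 0 0\<close> t by (simp add: algebra_simps)
      then have "hyp_split b c \<beta> P Q' 0 R" by (rule hyp_split_shear')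
      then show "hyp_split b c \<beta> P (Q - (- u) * R) (S + (- u) * P) R"
        using t by (simp add: Q'_def algebra_simps)
    qed
    then show ?thesis by (rule hyp_split_shear')
  qed
qed

theorem hyp_split_primitive:
  assumes prim: "\<And>k. k dvd \<beta> \<Longrightarrow> k dvd P \<Longrightarrow> k dvd Q \<Longrightarrow> k dvd R \<Longrightarrow> k dvd S \<Longrightarrow> k dvd 1"
    and D: "\<beta>\<^sup>2 + 4 * (P * Q + R * S) = b\<^sup>2 + 4 * c"
  shows "hyp_split b c \<beta> P Q R S"
proof -
  consider "P \<noteq> 0" | "Q \<noteq> 0" | "R \<noteq> 0" | "S \<noteq> 0" | "P = 0" "Q = 0" "R = 0" "S = 0" by blast
  then show ?thesis
  proof cases
    case 1 then show ?thesis using hyp_split_reduce assms by blast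
  next
    case 2
    show ?thesis
      by (rule hyp_split_swap_PQ, rule hyp_split_reduce) (use 2 assms in \<open>auto simp: algebra_simps\<close>)
  next
    case 3
    show ?thesis
      by (rule hyp_split_swap_pairs, rule hyp_split_reduce) (use 3 assms in \<open>auto simp: algebra_simps\<close>)
  next
    case 4
    show ?thesis
      by (rule hyp_split_swap_RS, rule hyp_split_swap_pairs, rule hyp_split_reduce)
        (use 4 assms in \<open>auto simp: algebra_simps\<close>)
  next
    case 5
    then have \<beta>: "\<beta> dvd 1" using prim by auto
    \<comment> \<open>Only \<open>\<beta>\<close> is nonzero, and it is a unit; a transvection with
      t = 1 copies it into S, where the descent can start.\<close>
    have "hyp_split b c \<beta> 0 0 0 (- \<beta>)"
    proof (rule hyp_split_swap_RS, rule hyp_split_swap_pairs, rule hyp_split_reduce)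
      show "k dvd 1" if "k dvd \<beta>" for k using \<beta> that by (rule dvd_trans[rotated])
    qed (use 5 D \<beta> in auto)
    then have "hyp_split b c (\<beta> + 2 * 1 * 0) 0 0 0 (0 - 1 * \<beta> - 1\<^sup>2 * 0)" by simp
    then show ?thesis using 5 hyp_split_eichler by blast
  qed
qed

section \<open>Negating the quaternary form\<close>

text \<open>The element \<open>E = (s, -s, 0, 1)\<close> is isotropic for \<open>u v - k\<^sup>2 - a k m + s\<^sup>2 m\<^sup>2\<close>, and the hyperbolic
  plane spanned by \<open>E\<close> and a dual isotropic vector has an orthogonal complement that represents \<open>1\<close>.\<close>

lemma hyp_form_negation:
  fixes a s :: int
  assumes "coprime a s"
  obtains \<phi> :: "int4 \<Rightarrow> int4" where "bij \<phi>" "\<And>X Y. \<phi> (X + Y) = \<phi> X + \<phi> Y"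
    "\<And>X. hyp_form a (s\<^sup>2) (\<phi> X) = - hyp_form a (s\<^sup>2) X"
proof -
  obtain \<alpha> \<gamma> where bez: "\<alpha> * a + \<gamma> * s = 1"
    using assms by (metis bezout_int coprime_iff_gcd_eq_1)
  \<comment> \<open>Coordinates with respect to E = (-s, -s, 0, 1), which differs from the vector
    above by the sign of u, F = (0, \<gamma>, -\<alpha>, 0), (-1, 1, 0, 0) and (0, a, s, 0). The
    Bezout relation says that E and F pair to -1; the last two are orthogonal to E and carry minus
    the binary form. The multiples of E collected in e make F isotropic and the last two orthogonal
    to it.\<close>
  define \<phi> :: "int4 \<Rightarrow> int4" where
    "\<phi> = (\<lambda>(i, j, k, m). let e = i + \<alpha>\<^sup>2 * j - \<gamma> * k - 2 * s * \<alpha> * m in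
      (- (e * s + k), - e * s + \<gamma> * j + k + a * m, - \<alpha> * j + s * m, e))"
  define \<psi> :: "int4 \<Rightarrow> int4" where
    "\<psi> = (\<lambda>(u, v, \<kappa>, e). let k = - u - s * e; j = s * (v + u) - a * \<kappa> + 2 * s\<^sup>2 * e;
      m = \<gamma> * \<kappa> + \<alpha> * (v + u + 2 * s * e) in (e - \<alpha>\<^sup>2 * j + \<gamma> * k + 2 * s * \<alpha> * m, j, k, m))"
  have "bij \<phi>"
  proof (rule bij_betwI[of _ _ _ \<psi>])
    show "\<psi> (\<phi> X) = X" for X
    proof (cases X)
      case (fields i j k m)
      define e where "e = i + \<alpha>\<^sup>2 * j - \<gamma> * k - 2 * s * \<alpha> * m"
      have "s * ((- e * s + \<gamma> * j + k + a * m) + - (e * s + k)) - a * (- \<alpha> * j + s * m) + 2 * s\<^sup>2 * e = (\<alpha> * a + \<gamma> * s) * j"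
        "\<gamma> * (- \<alpha> * j + s * m) + \<alpha> * ((- e * s + \<gamma> * j + k + a * m) + - (e * s + k) + 2 * s * e) = (\<alpha> * a + \<gamma> * s) * m"
        by (simp_all add: power2_eq_square algebra_simps)
      then show ?thesis
        unfolding fields \<phi>_def \<psi>_def Let_def prod.case e_def[symmetric] bez by (simp add: e_def)
    qed
    show "\<phi> (\<psi> X) = X" for X
    proof (cases X)
      case (fields u v \<kappa> e)
      define k where "k = - u - s * e"
      define j where "j = s * (v + u) - a * \<kappa> + 2 * s\<^sup>2 * e"
      define m where "m = \<gamma> * \<kappa> + \<alpha> * (v + u + 2 * s * e)"
      have "- e * s + \<gamma> * j + k + a * m = v"
      proof -
        have "- e * s + \<gamma> * j + k + a * m = (\<alpha> * a + \<gamma> * s) * (v + u + 2 * s * e) - u - 2 * s * e"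
          by (simp add: j_def k_def m_def power2_eq_square algebra_simps)
        then show ?thesis unfolding bez by simp
      qed
      moreover have "- \<alpha> * j + s * m = \<kappa>"
      proof -
        have "- \<alpha> * j + s * m = (\<alpha> * a + \<gamma> * s) * \<kappa>"
          by (simp add: j_def m_def power2_eq_square algebra_simps)
        then show ?thesis unfolding bez by simp
      qed
      moreover have "- (e * s + k) = u" by (simp add: k_def)
      ultimately show ?thesis
        unfolding fields \<phi>_def \<psi>_def Let_def prod.case k_def[symmetric] j_def[symmetric] m_def[symmetric]
        by simp
    qed
  qed auto
  moreover have "\<phi> (X + Y) = \<phi> X + \<phi> Y" for X Y
    by (cases X; cases Y) (simp add: \<phi>_def Let_def algebra_simps)
  moreover have "hyp_form a (s\<^sup>2) (\<phi> X) = - hyp_form a (s\<^sup>2) X" for X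
  proof (cases X)
    case (fields i j k m)
    define e where "e = i + \<alpha>\<^sup>2 * j - \<gamma> * k - 2 * s * \<alpha> * m"
    have i: "i = e - \<alpha>\<^sup>2 * j + \<gamma> * k + 2 * s * \<alpha> * m" by (simp add: e_def)
    have "hyp_form a (s\<^sup>2) (\<phi> X) = - (\<alpha> * a + \<gamma> * s) * (e * j) + \<alpha>\<^sup>2 * j\<^sup>2 - \<gamma> * k * j - 2 * s * \<alpha> * m * j
        - (k\<^sup>2 + a * k * m - s\<^sup>2 * m\<^sup>2)"
      unfolding fields \<phi>_def Let_def prod.case e_def[symmetric] hyp_form.simps
      by (simp add: power2_eq_square algebra_simps)
    then show ?thesis
      unfolding fields bez i hyp_form.simps by (simp add: power2_eq_square algebra_simps)
  qed
  ultimately show ?thesis using that by blast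
qed

text \<open>The vector \<open>(0, 0, -b, 2)\<close> has value \<open>-D\<close>, where \<open>D = b\<^sup>2 + 4 c\<close>, and pairs to multiples of \<open>D\<close>
  with the whole lattice; so its image is a vector of value \<open>D\<close> with the same divisibility.\<close>

lemma hyp_form_negation_square:
  fixes \<phi> :: "int4 \<Rightarrow> int4"
  assumes "surj \<phi>" and add: "\<And>X Y. \<phi> (X + Y) = \<phi> X + \<phi> Y"
    and neg: "\<And>X. hyp_form b c (\<phi> X) = - hyp_form b c X" and D: "b\<^sup>2 + 4 * c \<noteq> 0"
  shows "\<exists>m. b\<^sup>2 + 4 * c dvd m\<^sup>2 + 4"
proof -
  define D where "D = b\<^sup>2 + 4 * c"
  \<comment> \<open>The difference is the polar form at the image vector. By additivity and
    surjectivity it is minus a polar value at (0, 0, -b, 2), which is - D m.\<close>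
  have dvd: "D dvd hyp_form b c (\<phi> (0, 0, -b, 2) + Y) - hyp_form b c (\<phi> (0, 0, -b, 2)) - hyp_form b c Y" for Y
  proof -
    obtain X where X: "Y = \<phi> X" using assms(1) by (metis surj_def)
    obtain u v k m where X': "X = (u, v, k, m)" by (cases X)
    have "hyp_form b c (\<phi> (0, 0, -b, 2) + Y) = - hyp_form b c ((0, 0, -b, 2) + X)"
      unfolding X add[symmetric] neg ..
    then have "hyp_form b c (\<phi> (0, 0, -b, 2) + Y) - hyp_form b c (\<phi> (0, 0, -b, 2)) - hyp_form b c Y = D * m"
      unfolding X neg X' by (simp add: D_def power2_eq_square algebra_simps)
    then show ?thesis by simp
  qed
  obtain u v k m where w: "\<phi> (0, 0, -b, 2) = (u, v, k, m)" by (cases "\<phi> (0, 0, -b, 2)")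
  have "D dvd v" using dvd[of "(1, 0, 0, 0)"] unfolding w by (simp add: power2_eq_square algebra_simps)
  moreover have "D dvd u" using dvd[of "(0, 1, 0, 0)"] unfolding w by (simp add: power2_eq_square algebra_simps)
  moreover have "D dvd 2 * k + b * m" using dvd[of "(0, 0, 1, 0)"] unfolding w
    by (simp add: power2_eq_square algebra_simps)
  ultimately obtain u' v' t where e: "v = D * v'" "u = D * u'" "2 * k + b * m = D * t" by (auto elim!: dvdE)
  have "u * v + (k\<^sup>2 + b * k * m - c * m\<^sup>2) = D"
    using neg[of "(0, 0, -b, 2)"] unfolding w by (simp add: D_def power2_eq_square algebra_simps)
  \<comment> \<open>Completing the square in q. As u, v and 2 k + b m are multiples of D, this
    equation modulo D^2, with one factor D cancelled, leaves m^2 + 4 divisible by D.\<close>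
  then have "4 * u * v + (2 * k + b * m)\<^sup>2 - D * m\<^sup>2 = 4 * D"
    by (simp add: D_def power2_eq_square algebra_simps)
  then have "D * (m\<^sup>2 + 4) = D * (D * (4 * u' * v' + t\<^sup>2))"
    unfolding e by (simp add: power2_eq_square algebra_simps)
  then have "m\<^sup>2 + 4 = D * (4 * u' * v' + t\<^sup>2)" using D by (simp add: D_def)
  then show ?thesis unfolding D_def by (metis dvd_triv_left)
qed

lemma not_16_dvd_square_plus_4: "\<not> (16::int) dvd m\<^sup>2 + 4"
proof
  assume d: "16 dvd m\<^sup>2 + 4"
  then have "even (m\<^sup>2 + 4)" by (rule dvd_trans[rotated]) simp
  then have "even m" by simp
  then obtain j where j: "m = 2 * j" by auto
  then have "16 dvd 4 * (j\<^sup>2 + 1)" using d by (simp add: power2_eq_square algebra_simps)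
  then have 4: "4 dvd j\<^sup>2 + 1" by presburger
  then have "even (j\<^sup>2 + 1)" by (rule dvd_trans[rotated]) simp
  then have "odd j" by simp
  then obtain i where "j = 2 * i + 1" by (elim oddE)
  then have "j\<^sup>2 + 1 = 4 * (i * i + i) + 2" by (simp add: power2_eq_square algebra_simps)
  then show False using 4 by presburger
qed

section \<open>From isometries of T and N to self-maps that negate the form\<close>

definition sym_biadditive :: "'a::ab_group_add set \<Rightarrow> ('a \<Rightarrow> 'a \<Rightarrow> int) \<Rightarrow> bool" where
  "sym_biadditive A p \<longleftrightarrow> (\<forall>x\<in>A. \<forall>y\<in>A. x + y \<in> A \<and> p x y = p y x) \<and>
     (\<forall>x\<in>A. \<forall>y\<in>A. \<forall>z\<in>A. p (x + y) z = p x z + p y z)"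

lemma sym_biadditive_polarization:
  assumes "sym_biadditive A p" "x \<in> A" "y \<in> A"
  shows "2 * p x y = p (x + y) (x + y) - p x x - p y y"
proof -
  have "p (x + y) (x + y) = p x (x + y) + p y (x + y)" "p x (x + y) = p (x + y) x" "p y (x + y) = p (x + y) y"
    "p (x + y) x = p x x + p y x" "p (x + y) y = p x y + p y y" "p y x = p x y"
    using assms unfolding sym_biadditive_def by blast+
  then show ?thesis by simp
qed

text \<open>Conjugation with the charts, whose half norms are -h and h, turns an isometry into a map
  negating h. In the other direction it is enough to compare norms, because polarization recovers
  twice the pairing.\<close>

lemma lattice_isometry_coords_iff:
  fixes \<tau> :: "'c::ab_group_add \<Rightarrow> 'a::ab_group_add" and \<eta> :: "'c \<Rightarrow> 'b::ab_group_add" and h :: "'c \<Rightarrow> int"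
  assumes p: "sym_biadditive A p" and q: "sym_biadditive B q"
    and \<tau>: "bij_betw \<tau> UNIV A" "\<And>X Y. \<tau> (X + Y) = \<tau> X + \<tau> Y" "\<And>X. p (\<tau> X) (\<tau> X) = - 2 * h X"
    and \<eta>: "bij_betw \<eta> UNIV B" "\<And>X Y. \<eta> (X + Y) = \<eta> X + \<eta> Y" "\<And>X. q (\<eta> X) (\<eta> X) = 2 * h X"
  shows "(\<exists>\<phi>. lattice_isometry A p B q \<phi>) \<longleftrightarrow>
    (\<exists>\<psi>. bij \<psi> \<and> (\<forall>X Y. \<psi> (X + Y) = \<psi> X + \<psi> Y) \<and> (\<forall>X. h (\<psi> X) = - h X))"
proof
  assume "\<exists>\<phi>. lattice_isometry A p B q \<phi>"
  then obtain \<phi> where \<phi>: "bij_betw \<phi> A B" "\<And>x y. x \<in> A \<Longrightarrow> y \<in> A \<Longrightarrow> \<phi> (x + y) = \<phi> x + \<phi> y"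
    "\<And>x y. x \<in> A \<Longrightarrow> y \<in> A \<Longrightarrow> q (\<phi> x) (\<phi> y) = p x y" unfolding lattice_isometry_def by blast
  define \<eta>' where "\<eta>' = the_inv_into UNIV \<eta>"
  have \<eta>': "bij_betw \<eta>' B UNIV" unfolding \<eta>'_def using \<eta>(1) by (rule bij_betw_the_inv_into)
  have inj: "inj \<eta>" using \<eta>(1) by (rule bij_betw_imp_inj_on)
  have cancel: "\<eta> (\<eta>' x) = x" if "x \<in> B" for x
    unfolding \<eta>'_def using f_the_inv_into_f_bij_betw[OF \<eta>(1)] that by blast
  have \<tau>A: "\<tau> X \<in> A" for X using \<tau>(1) by (metis UNIV_I bij_betwE)
  have \<phi>B: "\<phi> x \<in> B" if "x \<in> A" for x using \<phi>(1) that by (metis bij_betwE)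
  define \<psi> where "\<psi> X = \<eta>' (\<phi> (\<tau> X))" for X
  have \<eta>\<psi>: "\<eta> (\<psi> X) = \<phi> (\<tau> X)" for X unfolding \<psi>_def by (rule cancel[OF \<phi>B[OF \<tau>A]])
  have "bij_betw (\<eta>' \<circ> (\<phi> \<circ> \<tau>)) UNIV UNIV" using \<tau>(1) \<phi>(1) \<eta>' by (meson bij_betw_trans)
  then have "bij \<psi>" by (simp add: \<psi>_def[abs_def] o_def)
  moreover have "\<psi> (X + Y) = \<psi> X + \<psi> Y" for X Y
  proof -
    have "\<eta> (\<psi> (X + Y)) = \<eta> (\<psi> X + \<psi> Y)"
      unfolding \<eta>(2) \<eta>\<psi> \<tau>(2) by (rule \<phi>(2)[OF \<tau>A \<tau>A])
    then show ?thesis using inj by (simp add: inj_eq)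
  qed
  moreover have "h (\<psi> X) = - h X" for X
  proof -
    have "2 * h (\<psi> X) = - 2 * h X"
      unfolding \<eta>(3)[symmetric] \<tau>(3)[symmetric] \<eta>\<psi> by (rule \<phi>(3)[OF \<tau>A \<tau>A])
    then show ?thesis by simp
  qed
  ultimately show "\<exists>\<psi>. bij \<psi> \<and> (\<forall>X Y. \<psi> (X + Y) = \<psi> X + \<psi> Y) \<and> (\<forall>X. h (\<psi> X) = - h X)" by blast
next
  assume "\<exists>\<psi>. bij \<psi> \<and> (\<forall>X Y. \<psi> (X + Y) = \<psi> X + \<psi> Y) \<and> (\<forall>X. h (\<psi> X) = - h X)"
  then obtain \<psi> where \<psi>: "bij \<psi>" "\<And>X Y. \<psi> (X + Y) = \<psi> X + \<psi> Y" "\<And>X. h (\<psi> X) = - h X" by blast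
  define \<tau>' where "\<tau>' = the_inv_into UNIV \<tau>"
  have \<tau>': "bij_betw \<tau>' A UNIV" unfolding \<tau>'_def using \<tau>(1) by (rule bij_betw_the_inv_into)
  have inj: "inj \<tau>" using \<tau>(1) by (rule bij_betw_imp_inj_on)
  have cancel: "\<tau> (\<tau>' x) = x" if "x \<in> A" for x
    unfolding \<tau>'_def using f_the_inv_into_f_bij_betw[OF \<tau>(1)] that by blast
  have \<tau>'_add: "\<tau>' (x + y) = \<tau>' x + \<tau>' y" if "x \<in> A" "y \<in> A" for x y
  proof -
    have "x + y \<in> A" using p that unfolding sym_biadditive_def by blast
    then have "\<tau> (\<tau>' (x + y)) = \<tau> (\<tau>' x + \<tau>' y)" unfolding \<tau>(2) using that by (simp add: cancel)
    then show ?thesis using inj by (simp add: inj_eq)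
  qed
  define \<phi> where "\<phi> x = \<eta> (\<psi> (\<tau>' x))" for x
  have "bij_betw (\<eta> \<circ> (\<psi> \<circ> \<tau>')) A B" using \<tau>' \<psi>(1) \<eta>(1) by (meson bij_betw_trans)
  then have bij: "bij_betw \<phi> A B" by (simp add: \<phi>_def[abs_def] o_def)
  have add: "\<phi> (x + y) = \<phi> x + \<phi> y" if "x \<in> A" "y \<in> A" for x y
    unfolding \<phi>_def \<tau>'_add[OF that] \<psi>(2) \<eta>(2) ..
  have diag: "q (\<phi> x) (\<phi> x) = p x x" if "x \<in> A" for x
  proof -
    have "q (\<phi> x) (\<phi> x) = - 2 * h (\<tau>' x)" unfolding \<phi>_def \<eta>(3) \<psi>(3) by simp
    also have "\<dots> = p x x" using \<tau>(3)[of "\<tau>' x"] cancel[OF that] by simp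
    finally show ?thesis .
  qed
  have "q (\<phi> x) (\<phi> y) = p x y" if xy: "x \<in> A" "y \<in> A" for x y
  proof -
    have mem: "\<phi> x \<in> B" "\<phi> y \<in> B" "x + y \<in> A"
      using bij xy p unfolding sym_biadditive_def by (auto dest: bij_betwE)
    have "2 * q (\<phi> x) (\<phi> y) = q (\<phi> (x + y)) (\<phi> (x + y)) - q (\<phi> x) (\<phi> x) - q (\<phi> y) (\<phi> y)"
      unfolding add[OF xy] by (rule sym_biadditive_polarization[OF q mem(1,2)])
    also have "\<dots> = 2 * p x y"
      unfolding diag[OF mem(3)] diag[OF xy(1)] diag[OF xy(2)]
      by (rule sym_biadditive_polarization[OF p xy, symmetric])
    finally show ?thesis by simp
  qed
  then show "\<exists>\<phi>. lattice_isometry A p B q \<phi>"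
    unfolding lattice_isometry_def using bij add by blast
qed

subsection \<open>Holomorphic functions on the plane and Chern classes\<close>

text \<open>The integral is Cauchy's expression, up to 2 pi \<i>, for the derivative along the
  complex line through v in direction d.\<close>

lemma continuous_on_Cauchy_derivative_integral:
  fixes g :: "C2 \<Rightarrow> complex" and d :: C2
  assumes "continuous_on UNIV g"
  shows "continuous_on UNIV (\<lambda>v. contour_integral (circlepath 0 1)
    (\<lambda>u. g (v + (u * fst d, u * snd d)) / (u - 0)\<^sup>2))"
proof -
  have "continuous_on UNIV (\<lambda>v. integral (cbox 0 1)
    (\<lambda>x. g (v + (circlepath 0 1 x * fst d, circlepath 0 1 x * snd d)) / (circlepath 0 1 x)\<^sup>2 *
       (2 * of_real pi * \<i> * exp (2 * of_real pi * \<i> * of_real x))))"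
    by (rule integral_continuous_on_param)
      (auto simp: circlepath case_prod_unfold intro!: continuous_intros
        continuous_on_compose2[OF assms])
  then show ?thesis
    by (simp add: contour_integral_integral vector_derivative_circlepath)
qed

lemma holomorphic_C2_continuous:
  assumes "holomorphic_C2 g"
  shows "continuous_on UNIV g"
proof (rule continuous_at_imp_continuous_on, rule ballI)
  fix v
  from assms obtain a b where "(g has_derivative (\<lambda>h. a * fst h + b * snd h)) (at v)"
    unfolding holomorphic_C2_def by blast
  then show "isCont g v" by (rule has_derivative_continuous)
qed

text \<open>Restricted to complex lines g is holomorphic in one variable, so Cauchy's formula writes
  its directional derivatives as integrals of g, which are continuous in v.\<close>

lemma holomorphic_C2_continuous_gradient:
  assumes "holomorphic_C2 g"
  obtains p q where "\<And>v. (g has_derivative (\<lambda>h. p v * fst h + q v * snd h)) (at v)"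
    "continuous_on UNIV p" "continuous_on UNIV q"
proof -
  from assms obtain p q where d: "\<And>v. (g has_derivative (\<lambda>h. p v * fst h + q v * snd h)) (at v)"
    unfolding holomorphic_C2_def by metis
  have cont: "continuous_on UNIV g"
    using assms by (rule holomorphic_C2_continuous)
  have "continuous_on UNIV (\<lambda>v. p v * fst e + q v * snd e)" for e :: C2
  proof -
    have fd: "((\<lambda>z. g (v + (z * fst e, z * snd e))) has_field_derivative
        (p (v + (z * fst e, z * snd e)) * fst e + q (v + (z * fst e, z * snd e)) * snd e)) (at z)" for v z
    proof -
      have "((\<lambda>z. v + (z * fst e, z * snd e)) has_derivative (\<lambda>h. (h * fst e, h * snd e))) (at z)"
        by (auto intro!: derivative_eq_intros)
      from diff_chain_at[OF this d]
      show ?thesis unfolding has_field_derivative_def o_def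
        by (rule has_derivative_eq_rhs) (auto simp: algebra_simps)
    qed
    have "p v * fst e + q v * snd e = 1 / (2 * of_real pi * \<i>) * contour_integral (circlepath 0 1)
      (\<lambda>u. g (v + (u * fst e, u * snd e)) / (u - 0)\<^sup>2)" for v
    proof -
      have hol: "(\<lambda>z. g (v + (z * fst e, z * snd e))) holomorphic_on UNIV"
        using fd[of v] by (meson field_differentiable_def holomorphic_onI has_field_derivative_at_within)
      have "((\<lambda>z. g (v + (z * fst e, z * snd e))) has_field_derivative
         (1 / (2 * of_real pi * \<i>) * contour_integral (circlepath 0 1)
            (\<lambda>u. g (v + (u * fst e, u * snd e)) / (u - 0)\<^sup>2))) (at 0)"
        by (rule Cauchy_derivative_integral_circlepath(2))
          (use hol in \<open>auto intro: holomorphic_on_subset[OF hol] holomorphic_on_imp_continuous_on\<close>)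
      from DERIV_unique[OF fd[of v 0] this] show ?thesis by (simp flip: zero_prod_def)
    qed
    then show ?thesis
      using continuous_on_mult_left[OF continuous_on_Cauchy_derivative_integral[OF cont, of e]]
      by (simp only:)
  qed
  from this[of "(1, 0)"] this[of "(0, 1)"] have "continuous_on UNIV p" "continuous_on UNIV q" by simp_all
  with d show ?thesis by (rule that)
qed

text \<open>Iterated averages play the role of integrals over the faces and the interior of a
  parallelepiped.\<close>

definition average :: "C2 \<Rightarrow> (C2 \<Rightarrow> complex) \<Rightarrow> C2 \<Rightarrow> complex" where
  "average a g v = integral {0..1} (\<lambda>t. g (v + t *\<^sub>R a))"

lemma continuous_on_average:
  assumes "continuous_on UNIV g"
  shows "continuous_on UNIV (average a g)"
proof -
  have "continuous_on UNIV (\<lambda>v. integral (cbox 0 1) (\<lambda>t. g (v + t *\<^sub>R a)))"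
    by (rule integral_continuous_on_param)
      (auto simp: case_prod_unfold intro!: continuous_intros continuous_on_compose2[OF assms])
  then show ?thesis by (simp add: average_def[abs_def])
qed

lemma average_integrable:
  fixes g :: "C2 \<Rightarrow> complex"
  assumes "continuous_on UNIV g"
  shows "(\<lambda>t::real. g (v + t *\<^sub>R a)) integrable_on {0..1}"
  by (rule integrable_continuous_real, rule continuous_on_compose2[OF assms])
    (auto intro!: continuous_intros)

lemma average_commute:
  assumes "continuous_on UNIV g"
  shows "average a (average b g) = average b (average a g)"
proof
  fix v
  have "integral (cbox 0 1) (\<lambda>s::real. integral (cbox 0 1) (\<lambda>t::real. g (v + s *\<^sub>R a + t *\<^sub>R b))) =
    integral (cbox 0 1) (\<lambda>t. integral (cbox 0 1) (\<lambda>s. g (v + s *\<^sub>R a + t *\<^sub>R b)))"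
    by (rule integral_swap_continuous)
      (auto simp: case_prod_unfold intro!: continuous_intros continuous_on_compose2[OF assms])
  then show "average a (average b g) v = average b (average a g) v"
    by (simp add: average_def algebra_simps)
qed

lemma average_mult_left: "average a (\<lambda>v. c * g v) = (\<lambda>v. c * average a g v)"
  by (auto simp: average_def)

lemma average_add:
  assumes "continuous_on UNIV f" "continuous_on UNIV g"
  shows "average a (\<lambda>v. f v + g v) = (\<lambda>v. average a f v + average a g v)"
  unfolding average_def using assms by (intro ext integral_add average_integrable)

lemma average_diff:
  assumes "continuous_on UNIV f" "continuous_on UNIV g"
  shows "average a (\<lambda>v. f v - g v) = (\<lambda>v. average a f v - average a g v)"
  unfolding average_def using assms by (intro ext integral_diff average_integrable)

lemma average_const [simp]: "average a (\<lambda>v. c) = (\<lambda>v. c)"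
  by (auto simp: average_def)

lemma average_derivative:
  assumes "\<And>v. (g has_derivative (\<lambda>h. p v * fst h + q v * snd h)) (at v)"
  shows "average a (\<lambda>v. p v * fst a + q v * snd a) v = g (v + a) - g v"
proof -
  have "((\<lambda>t. g (v + t *\<^sub>R a)) has_vector_derivative
      p (v + t *\<^sub>R a) * fst a + q (v + t *\<^sub>R a) * snd a) (at t within {0..1})" for t :: real
  proof -
    have "((\<lambda>t. v + t *\<^sub>R a) has_derivative (\<lambda>h. h *\<^sub>R a)) (at t within {0..1})"
      by (auto intro!: derivative_eq_intros)
    from has_derivative_compose[OF this assms]
    show ?thesis by (simp add: has_vector_derivative_def algebra_simps)
  qed
  then have "((\<lambda>t. p (v + t *\<^sub>R a) * fst a + q (v + t *\<^sub>R a) * snd a) has_integral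
    g (v + 1 *\<^sub>R a) - g (v + 0 *\<^sub>R a)) {0..1}"
    by (intro fundamental_theorem_of_calculus) auto
  then show ?thesis by (simp add: average_def integral_unique)
qed

definition cdet :: "C2 \<Rightarrow> C2 \<Rightarrow> complex" where
  "cdet v w = fst v * snd w - snd v * fst w"

text \<open>Stokes' theorem for the closed form \<open>g dz\<^sub>1 \<and> dz\<^sub>2\<close> on the parallelepiped spanned by \<open>a, b, c\<close>.\<close>

lemma holomorphic_Stokes:
  assumes "holomorphic_C2 g"
  shows "cdet b c * average b (average c (\<lambda>v. g (v + a) - g v)) v
       - cdet a c * average a (average c (\<lambda>v. g (v + b) - g v)) v
       + cdet a b * average a (average b (\<lambda>v. g (v + c) - g v)) v = 0"
proof -
  obtain p q where d: "\<And>v. (g has_derivative (\<lambda>h. p v * fst h + q v * snd h)) (at v)"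
    and pq: "continuous_on UNIV p" "continuous_on UNIV q"
    using holomorphic_C2_continuous_gradient[OF assms] by metis
  define G where "G x = (\<lambda>v. p v * fst x + q v * snd x)" for x
  have G: "continuous_on UNIV (G x)" for x unfolding G_def by (intro continuous_intros pq)
  note cont = G continuous_on_average
  have diff: "(\<lambda>v. g (v + x) - g v) = average x (G x)" for x
    unfolding G_def by (rule ext, rule average_derivative[OF d, symmetric])
  \<comment> \<open>T integrates over the solid. By Fubini the order of the directions is
    irrelevant, so every difference of opposite faces becomes T of a directional derivative.\<close>
  define T where "T F = average a (average b (average c F))" for F
  have 1: "average b (average c (average a F)) = T F" if "continuous_on UNIV F" for F
    unfolding T_def using that by (metis average_commute continuous_on_average)
  have 2: "average a (average c (average b F)) = T F" if "continuous_on UNIV F" for F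
    unfolding T_def using that by (metis average_commute)
  have scale: "z * T F v = T (\<lambda>v. z * F v) v" for z F
    unfolding T_def average_mult_left ..
  have "cdet b c * T (G a) v - cdet a c * T (G b) v + cdet a b * T (G c) v
      = T (\<lambda>v. cdet b c * G a v - cdet a c * G b v + cdet a b * G c v) v"
  proof -
    have "T (\<lambda>v. F v - F' v + F'' v) v = T F v - T F' v + T F'' v"
      if "continuous_on UNIV F" "continuous_on UNIV F'" "continuous_on UNIV F''" for F F' F''
      unfolding T_def using that
      by (simp add: average_add average_diff continuous_on_average continuous_on_diff
          continuous_on_add)
    then show ?thesis unfolding scale by (simp add: G continuous_on_mult_left)
  qed
  \<comment> \<open>Cramer's identity cdet(b, c) a - cdet(a, c) b + cdet(a, b) c = 0 in C^2; it
    expresses that the form is closed.\<close>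
  also have "(\<lambda>v. cdet b c * G a v - cdet a c * G b v + cdet a b * G c v) = (\<lambda>v. 0)"
    by (auto simp: G_def cdet_def algebra_simps)
  also have "T (\<lambda>v. 0) v = 0" unfolding T_def average_def by simp
  finally show ?thesis unfolding diff by (simp add: 1 2 G) (simp add: T_def)
qed

text \<open>For each of the four vectors n, Stokes' theorem is applied to f n on the parallelepiped
  of the other three. In the alternating sum of these identities the face integrals of f i and f j
  combine to E i j, weighted by \<open>cdet\<close> of the complementary pair.\<close>

lemma Chern_class_wedge_cdet:
  fixes f :: "C2 \<Rightarrow> C2 \<Rightarrow> complex" and E :: form
  assumes hol: "\<And>l. l \<in> {b1, b2, b3, b4} \<Longrightarrow> holomorphic_C2 (f l)"
    and E: "\<And>l m v. l \<in> {b1, b2, b3, b4} \<Longrightarrow> m \<in> {b1, b2, b3, b4} \<Longrightarrow>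
      of_real (E l m) = f m (v + l) + f l v - f l (v + m) - f m v"
  shows "of_real (E b1 b2) * cdet b3 b4 - of_real (E b1 b3) * cdet b2 b4 + of_real (E b1 b4) * cdet b2 b3
   + of_real (E b2 b3) * cdet b1 b4 - of_real (E b2 b4) * cdet b1 b3 + of_real (E b3 b4) * cdet b1 b2 = 0"
proof -
  let ?B = "{b1, b2, b3, b4}"
  define X where "X k l i j = average k (average l (\<lambda>v. f j (v + i) - f j v)) 0" for k l i j
  have cont: "continuous_on UNIV (\<lambda>v. f j (v + i) - f j v)" if "j \<in> ?B" for i j
  proof -
    have "continuous_on UNIV (f j)"
      using hol[OF that] by (rule holomorphic_C2_continuous)
    then show ?thesis by (intro continuous_intros continuous_on_compose2[OF \<open>continuous_on UNIV (f j)\<close>]) auto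
  qed
  \<comment> \<open>A constant equals its averages, so E i j may be computed on whichever face is
    required.\<close>
  have avg: "of_real (E i j) = X k l i j - X k l j i" if "i \<in> ?B" "j \<in> ?B" for i j k l
  proof -
    have "(\<lambda>v. complex_of_real (E i j)) = (\<lambda>v. (f j (v + i) - f j v) - (f i (v + j) - f i v))"
      proof
      show "of_real (E i j) = (f j (v + i) - f j v) - (f i (v + j) - f i v)" for v
        unfolding E[OF that, of v] by simp
    qed
    then have "average k (average l (\<lambda>v. complex_of_real (E i j))) 0 =
       average k (average l (\<lambda>v. (f j (v + i) - f j v) - (f i (v + j) - f i v))) 0" by simp
    then show ?thesis using cont that unfolding X_def
      by (simp add: average_diff continuous_on_average)
  qed
  have st: "cdet j k * X j k i n - cdet i k * X i k j n + cdet i j * X i j k n = 0" if "n \<in> ?B" for i j k n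
    using holomorphic_Stokes[OF hol[OF that], of j k i 0] unfolding X_def by simp
  define S where "S n i j k = cdet j k * X j k i n - cdet i k * X i k j n + cdet i j * X i j k n" for n i j k
  have "of_real (E b1 b2) * cdet b3 b4 - of_real (E b1 b3) * cdet b2 b4 + of_real (E b1 b4) * cdet b2 b3
     + of_real (E b2 b3) * cdet b1 b4 - of_real (E b2 b4) * cdet b1 b3 + of_real (E b3 b4) * cdet b1 b2
     = - S b1 b2 b3 b4 + S b2 b1 b3 b4 - S b3 b1 b2 b4 + S b4 b1 b2 b3"
    unfolding avg[of b1 b2 b3 b4, simplified] avg[of b1 b3 b2 b4, simplified] avg[of b1 b4 b2 b3, simplified]
      avg[of b2 b3 b1 b4, simplified] avg[of b2 b4 b1 b3, simplified] avg[of b3 b4 b1 b2, simplified] S_def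
    by (simp add: algebra_simps)
  also have "\<dots> = 0" using st unfolding S_def by simp
  finally show ?thesis .
qed

subsection \<open>Alternating forms and the cup product\<close>

definition alternating :: "form \<Rightarrow> bool" where
  "alternating E \<longleftrightarrow> bilinear E \<and> (\<forall>v. E v v = 0)"

lemma alternating_swap:
  assumes "alternating E"
  shows "E w v = - E v w"
proof -
  have bil: "bilinear E" and alt: "\<And>v. E v v = 0" using assms by (auto simp: alternating_def)
  have "E (v + w) (v + w) = E v v + E v w + (E w v + E w w)"
    by (simp add: bilinear_ladd[OF bil] bilinear_radd[OF bil])
  then show ?thesis using alt by simp
qed

definition std_form :: "real \<Rightarrow> real \<Rightarrow> real \<Rightarrow> real \<Rightarrow> real \<Rightarrow> real \<Rightarrow> form" where
  "std_form c12 c13 c14 c23 c24 c34 v w =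
     c12 * (Re (fst v) * Im (fst w) - Im (fst v) * Re (fst w))
   + c13 * (Re (fst v) * Re (snd w) - Re (snd v) * Re (fst w))
   + c14 * (Re (fst v) * Im (snd w) - Im (snd v) * Re (fst w))
   + c23 * (Im (fst v) * Re (snd w) - Re (snd v) * Im (fst w))
   + c24 * (Im (fst v) * Im (snd w) - Im (snd v) * Im (fst w))
   + c34 * (Re (snd v) * Im (snd w) - Im (snd v) * Re (snd w))"

text \<open>\<open>C2\<close> doubles as real 4-space: the real and imaginary parts of v are the
  coefficients. A lattice is then the image of the integral points, and the standard basis gives the
  identity.\<close>

definition of_coords :: "C2 \<Rightarrow> C2 \<Rightarrow> C2 \<Rightarrow> C2 \<Rightarrow> C2 \<Rightarrow> C2" where
  "of_coords b1 b2 b3 b4 v = Re (fst v) *\<^sub>R b1 + Im (fst v) *\<^sub>R b2 + Re (snd v) *\<^sub>R b3 + Im (snd v) *\<^sub>R b4"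

lemma linear_of_coords: "linear (of_coords b1 b2 b3 b4)"
  by (rule linearI) (auto simp: of_coords_def algebra_simps)

lemma of_coords_std: "of_coords (1, 0) (\<i>, 0) (0, 1) (0, \<i>) v = v"
  by (cases v) (auto simp: of_coords_def complex_eq_iff)

lemma alternating_of_coords:
  assumes "alternating E"
  shows "E (of_coords b1 b2 b3 b4 v) (of_coords b1 b2 b3 b4 w) =
    std_form (E b1 b2) (E b1 b3) (E b1 b4) (E b2 b3) (E b2 b4) (E b3 b4) v w"
proof -
  have bil: "bilinear E" and alt: "\<And>v. E v v = 0" using assms by (auto simp: alternating_def)
  note rules = bilinear_ladd[OF bil] bilinear_radd[OF bil] bilinear_lmul[OF bil] bilinear_rmul[OF bil]
  show ?thesis
    unfolding of_coords_def std_form_def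
    by (simp add: rules alt alternating_swap[OF assms, of b2 b1] alternating_swap[OF assms, of b3 b1]
        alternating_swap[OF assms, of b4 b1] alternating_swap[OF assms, of b3 b2]
        alternating_swap[OF assms, of b4 b2] alternating_swap[OF assms, of b4 b3] algebra_simps)
qed

lemma wedge_std_form:
  "wedge (std_form c12 c13 c14 c23 c24 c34) (std_form d12 d13 d14 d23 d24 d34) v1 v2 v3 v4 =
   volume v1 v2 v3 v4 * (c12 * d34 - c13 * d24 + c14 * d23 + c23 * d14 - c24 * d13 + c34 * d12)"
proof -
  obtain x1 x2 x3 x4 where v1: "v1 = (Complex x1 x2, Complex x3 x4)" by (metis complex.exhaust surj_pair)
  obtain y1 y2 y3 y4 where v2: "v2 = (Complex y1 y2, Complex y3 y4)" by (metis complex.exhaust surj_pair)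
  obtain z1 z2 z3 z4 where v3: "v3 = (Complex z1 z2, Complex z3 z4)" by (metis complex.exhaust surj_pair)
  obtain w1 w2 w3 w4 where v4: "v4 = (Complex w1 w2, Complex w3 w4)" by (metis complex.exhaust surj_pair)
  show ?thesis
    unfolding v1 v2 v3 v4 wedge_def volume_def std_form_def fst_conv snd_conv complex.sel
    by (simp only: algebra_simps)
qed

text \<open>Alternating 4-forms on real 4-space are multiples of the determinant, which is
  \<open>volume\<close>. This gives both the basis independence of the cup product and the passage
  between lattice and standard basis.\<close>

theorem wedge_of_coords:
  assumes "alternating E" "alternating F"
  shows "wedge E F (of_coords b1 b2 b3 b4 v1) (of_coords b1 b2 b3 b4 v2)
      (of_coords b1 b2 b3 b4 v3) (of_coords b1 b2 b3 b4 v4) =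
    volume v1 v2 v3 v4 * wedge E F b1 b2 b3 b4"
proof -
  define e where "e i j = E i j" for i j
  define f where "f i j = F i j" for i j
  have "wedge E F (of_coords b1 b2 b3 b4 v1) (of_coords b1 b2 b3 b4 v2)
      (of_coords b1 b2 b3 b4 v3) (of_coords b1 b2 b3 b4 v4) =
    wedge (std_form (E b1 b2) (E b1 b3) (E b1 b4) (E b2 b3) (E b2 b4) (E b3 b4))
      (std_form (F b1 b2) (F b1 b3) (F b1 b4) (F b2 b3) (F b2 b4) (F b3 b4)) v1 v2 v3 v4"
    unfolding wedge_def alternating_of_coords[OF assms(1)] alternating_of_coords[OF assms(2)] ..
  then show ?thesis unfolding wedge_std_form by (simp add: wedge_def)
qed

lemma alternating_std_form: "alternating (std_form c12 c13 c14 c23 c24 c34)"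
  unfolding alternating_def bilinear_def
  by (auto intro!: linearI simp: std_form_def algebra_simps)

lemma alternating_volume_forms:
  "alternating (\<lambda>v w. Re (fst v) * Im (fst w) - Im (fst v) * Re (fst w))"
  "alternating (\<lambda>v w. Re (snd v) * Im (snd w) - Im (snd v) * Re (snd w))"
  using alternating_std_form[of 1 0 0 0 0 0] alternating_std_form[of 0 0 0 0 0 1]
  by (simp_all add: std_form_def[abs_def])

lemma volume_of_coords:
  "volume (of_coords b1 b2 b3 b4 v1) (of_coords b1 b2 b3 b4 v2)
      (of_coords b1 b2 b3 b4 v3) (of_coords b1 b2 b3 b4 v4) = volume v1 v2 v3 v4 * volume b1 b2 b3 b4"
  unfolding volume_def using wedge_of_coords[OF alternating_volume_forms]
  by (simp add: volume_def)

lemma volume_std: "volume (1, 0) (\<i>, 0) (0, 1) (0, \<i>) = 1"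
  by (simp add: volume_def wedge_def)

lemma std_form_std:
  assumes "alternating E"
  shows "E v w = std_form (E (1, 0) (\<i>, 0)) (E (1, 0) (0, 1)) (E (1, 0) (0, \<i>))
    (E (\<i>, 0) (0, 1)) (E (\<i>, 0) (0, \<i>)) (E (0, 1) (0, \<i>)) v w"
  using alternating_of_coords[OF assms, of "(1, 0)" "(\<i>, 0)" "(0, 1)" "(0, \<i>)" v w]
  by (simp only: of_coords_std)

section \<open>Lattice bases and the intersection number\<close>

definition integral_point :: "C2 \<Rightarrow> bool" where
  "integral_point v \<longleftrightarrow> Re (fst v) \<in> \<int> \<and> Im (fst v) \<in> \<int> \<and> Re (snd v) \<in> \<int> \<and> Im (snd v) \<in> \<int>"

lemma volume_integral_point:
  "integral_point v1 \<Longrightarrow> integral_point v2 \<Longrightarrow> integral_point v3 \<Longrightarrow> integral_point v4 \<Longrightarrow>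
    volume v1 v2 v3 v4 \<in> \<int>"
  unfolding volume_def wedge_def integral_point_def by auto

lemma lattice_basis_iff:
  "lattice_basis \<Lambda> b1 b2 b3 b4 \<longleftrightarrow>
    inj (of_coords b1 b2 b3 b4) \<and> \<Lambda> = of_coords b1 b2 b3 b4 ` {v. integral_point v}"
proof -
  have "inj (of_coords b1 b2 b3 b4) \<longleftrightarrow>
    (\<forall>r1 r2 r3 r4 :: real. r1 *\<^sub>R b1 + r2 *\<^sub>R b2 + r3 *\<^sub>R b3 + r4 *\<^sub>R b4 = 0 \<longrightarrow>
        r1 = 0 \<and> r2 = 0 \<and> r3 = 0 \<and> r4 = 0)" (is "_ \<longleftrightarrow> ?R")
  proof -
    have "inj (of_coords b1 b2 b3 b4) \<longleftrightarrow> (\<forall>v. of_coords b1 b2 b3 b4 v = 0 \<longrightarrow> v = 0)"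
      by (rule linear_injective_0[OF linear_of_coords])
    also have "\<dots> \<longleftrightarrow> ?R"
    proof
      assume h: "\<forall>v. of_coords b1 b2 b3 b4 v = 0 \<longrightarrow> v = 0"
      show ?R
      proof (intro allI impI)
        fix r1 r2 r3 r4 :: real
        assume "r1 *\<^sub>R b1 + r2 *\<^sub>R b2 + r3 *\<^sub>R b3 + r4 *\<^sub>R b4 = 0"
        then have "of_coords b1 b2 b3 b4 (Complex r1 r2, Complex r3 r4) = 0" by (simp add: of_coords_def)
        with h have "(Complex r1 r2, Complex r3 r4) = 0" by blast
        then show "r1 = 0 \<and> r2 = 0 \<and> r3 = 0 \<and> r4 = 0" by (simp add: zero_prod_def complex_eq_iff)
      qed
    next
      assume ?R
      then show "\<forall>v. of_coords b1 b2 b3 b4 v = 0 \<longrightarrow> v = 0"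
        unfolding of_coords_def by (metis complex_eq_iff prod_eq_iff zero_complex.sel fst_zero snd_zero)
    qed
    finally show ?thesis .
  qed
  moreover have "of_coords b1 b2 b3 b4 ` {v. integral_point v} =
    {of_int n1 *\<^sub>R b1 + of_int n2 *\<^sub>R b2 + of_int n3 *\<^sub>R b3 + of_int n4 *\<^sub>R b4 | n1 n2 n3 n4. True}"
    (is "?A = ?B")
  proof
    show "?A \<subseteq> ?B"
    proof
      fix x assume "x \<in> ?A"
      then obtain v where v: "integral_point v" "x = of_coords b1 b2 b3 b4 v" by blast
      then obtain n1 n2 n3 n4 :: int where "Re (fst v) = of_int n1" "Im (fst v) = of_int n2"
        "Re (snd v) = of_int n3" "Im (snd v) = of_int n4"
        unfolding integral_point_def by (elim conjE Ints_cases) blast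
      then show "x \<in> ?B" using v(2) unfolding of_coords_def by auto
    qed
    show "?B \<subseteq> ?A"
    proof
      fix x assume "x \<in> ?B"
      then obtain n1 n2 n3 n4 :: int where
        "x = of_int n1 *\<^sub>R b1 + of_int n2 *\<^sub>R b2 + of_int n3 *\<^sub>R b3 + of_int n4 *\<^sub>R b4" by blast
      then have "x = of_coords b1 b2 b3 b4 (Complex (of_int n1) (of_int n2), Complex (of_int n3) (of_int n4))"
        by (simp add: of_coords_def)
      then show "x \<in> ?A" by (rule image_eqI) (simp add: integral_point_def)
    qed
  qed
  ultimately show ?thesis unfolding lattice_basis_def by simp
qed

lemma lattice_basis_bij:
  assumes "lattice_basis \<Lambda> b1 b2 b3 b4"
  shows "bij (of_coords b1 b2 b3 b4)"
  using assms linear_injective_imp_surjective[OF linear_of_coords]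
  by (auto simp: lattice_basis_iff bij_def)

lemma of_coords_units:
  "of_coords b1 b2 b3 b4 (1, 0) = b1" "of_coords b1 b2 b3 b4 (\<i>, 0) = b2"
  "of_coords b1 b2 b3 b4 (0, 1) = b3" "of_coords b1 b2 b3 b4 (0, \<i>) = b4"
  by (simp_all add: of_coords_def)

lemma lattice_basis_mem:
  assumes "lattice_basis \<Lambda> b1 b2 b3 b4"
  shows "b1 \<in> \<Lambda>" "b2 \<in> \<Lambda>" "b3 \<in> \<Lambda>" "b4 \<in> \<Lambda>"
proof -
  have "of_coords b1 b2 b3 b4 v \<in> \<Lambda>" if "integral_point v" for v
    using assms that by (auto simp: lattice_basis_iff)
  from this[of "(1, 0)"] this[of "(\<i>, 0)"] this[of "(0, 1)"] this[of "(0, \<i>)"]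
  show "b1 \<in> \<Lambda>" "b2 \<in> \<Lambda>" "b3 \<in> \<Lambda>" "b4 \<in> \<Lambda>"
    by (simp_all add: of_coords_units integral_point_def)
qed

lemma lattice_basis_volume:
  assumes "lattice_basis \<Lambda> b1 b2 b3 b4"
  shows "volume b1 b2 b3 b4 \<noteq> 0"
proof -
  have "surj (of_coords b1 b2 b3 b4)" using lattice_basis_bij[OF assms] by (rule bij_is_surj)
  then obtain v1 v2 v3 v4 where "of_coords b1 b2 b3 b4 v1 = (1, 0)" "of_coords b1 b2 b3 b4 v2 = (\<i>, 0)"
    "of_coords b1 b2 b3 b4 v3 = (0, 1)" "of_coords b1 b2 b3 b4 v4 = (0, \<i>)" by (metis surjD)
  then have "1 = volume v1 v2 v3 v4 * volume b1 b2 b3 b4"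
    using volume_of_coords[of b1 b2 b3 b4 v1 v2 v3 v4] volume_std by simp
  then show ?thesis by auto
qed

text \<open>The two transition matrices are integral with determinants inverse to each other, so the
  determinant \<epsilon> is a unit.\<close>

lemma lattice_basis_change:
  assumes b: "lattice_basis \<Lambda> b1 b2 b3 b4" and c: "lattice_basis \<Lambda> c1 c2 c3 c4"
  obtains \<epsilon> :: real where "\<epsilon> = 1 \<or> \<epsilon> = -1" "volume c1 c2 c3 c4 = \<epsilon> * volume b1 b2 b3 b4"
    "\<And>E F. alternating E \<Longrightarrow> alternating F \<Longrightarrow> wedge E F c1 c2 c3 c4 = \<epsilon> * wedge E F b1 b2 b3 b4"
proof -
  have "\<exists>v. integral_point v \<and> of_coords b1 b2 b3 b4 v = l" if "l \<in> \<Lambda>" for l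
    using b that by (auto simp: lattice_basis_iff)
  then obtain n1 n2 n3 n4 where n: "integral_point n1" "integral_point n2" "integral_point n3" "integral_point n4"
    "c1 = of_coords b1 b2 b3 b4 n1" "c2 = of_coords b1 b2 b3 b4 n2"
    "c3 = of_coords b1 b2 b3 b4 n3" "c4 = of_coords b1 b2 b3 b4 n4"
    using lattice_basis_mem[OF c] by metis
  have "\<exists>v. integral_point v \<and> of_coords c1 c2 c3 c4 v = l" if "l \<in> \<Lambda>" for l
    using c that by (auto simp: lattice_basis_iff)
  then obtain m1 m2 m3 m4 where m: "integral_point m1" "integral_point m2" "integral_point m3" "integral_point m4"
    "b1 = of_coords c1 c2 c3 c4 m1" "b2 = of_coords c1 c2 c3 c4 m2"
    "b3 = of_coords c1 c2 c3 c4 m3" "b4 = of_coords c1 c2 c3 c4 m4"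
    using lattice_basis_mem[OF b] by metis
  define \<epsilon> where "\<epsilon> = volume n1 n2 n3 n4"
  have vc: "volume c1 c2 c3 c4 = \<epsilon> * volume b1 b2 b3 b4"
    unfolding n \<epsilon>_def by (rule volume_of_coords)
  have vb: "volume b1 b2 b3 b4 = volume m1 m2 m3 m4 * volume c1 c2 c3 c4"
    unfolding m by (rule volume_of_coords)
  have "volume m1 m2 m3 m4 * \<epsilon> = 1" using vb lattice_basis_volume[OF b] unfolding vc by simp
  moreover have "volume m1 m2 m3 m4 \<in> \<int>" "\<epsilon> \<in> \<int>"
    unfolding \<epsilon>_def by (rule volume_integral_point[OF m(1-4)], rule volume_integral_point[OF n(1-4)])
  ultimately have "\<epsilon> = 1 \<or> \<epsilon> = -1"
    by (elim Ints_cases) (metis mult.commute of_int_1 of_int_eq_iff of_int_minus of_int_mult zmult_eq_1_iff)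
  moreover have "wedge E F c1 c2 c3 c4 = \<epsilon> * wedge E F b1 b2 b3 b4" if "alternating E" "alternating F" for E F
    unfolding n \<epsilon>_def by (rule wedge_of_coords[OF that])
  ultimately show ?thesis using that vc by blast
qed

lemma H2_alternating: "E \<in> H2 \<Lambda> \<Longrightarrow> alternating E"
  by (simp add: H2_def alternating_def)

text \<open>The sign \<epsilon> of a change of basis occurs in the sign of the volume and in the
  wedge, and cancels; thus the value in one basis satisfies the definite description.\<close>

lemma intersection_eq:
  assumes b: "lattice_basis \<Lambda> b1 b2 b3 b4" and EF: "E \<in> H2 \<Lambda>" "F \<in> H2 \<Lambda>"
  shows "of_int (intersection \<Lambda> E F) = sgn (volume b1 b2 b3 b4) * wedge E F b1 b2 b3 b4"
proof -
  note mem = lattice_basis_mem[OF b]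
  have "wedge E F b1 b2 b3 b4 \<in> \<int>"
    using EF mem unfolding wedge_def H2_def by auto
  then have "sgn (volume b1 b2 b3 b4) * wedge E F b1 b2 b3 b4 \<in> \<int>" by (auto simp: sgn_if)
  then obtain m where m: "of_int m = sgn (volume b1 b2 b3 b4) * wedge E F b1 b2 b3 b4"
    by (metis Ints_cases)
  have "intersection \<Lambda> E F = m"
    unfolding intersection_def
  proof (rule the_equality)
    show "\<forall>c1 c2 c3 c4. lattice_basis \<Lambda> c1 c2 c3 c4 \<longrightarrow>
      of_int m = sgn (volume c1 c2 c3 c4) * wedge E F c1 c2 c3 c4"
    proof (intro allI impI)
      fix c1 c2 c3 c4 assume "lattice_basis \<Lambda> c1 c2 c3 c4"
      from lattice_basis_change[OF b this] obtain \<epsilon> :: real where "\<epsilon> = 1 \<or> \<epsilon> = -1"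
        "volume c1 c2 c3 c4 = \<epsilon> * volume b1 b2 b3 b4"
        "wedge E F c1 c2 c3 c4 = \<epsilon> * wedge E F b1 b2 b3 b4"
        using H2_alternating EF by metis
      then show "of_int m = sgn (volume c1 c2 c3 c4) * wedge E F c1 c2 c3 c4"
        unfolding m by (auto simp: sgn_mult)
    qed
    show "n = m" if "\<forall>c1 c2 c3 c4. lattice_basis \<Lambda> c1 c2 c3 c4 \<longrightarrow>
      of_int n = sgn (volume c1 c2 c3 c4) * wedge E F c1 c2 c3 c4" for n
      using that b m by (metis of_int_eq_iff)
  qed
  with m show ?thesis by simp
qed

section \<open>Classes of type (1,1) and lattice coordinates\<close>

definition i_invariant :: "form \<Rightarrow> bool" where
  "i_invariant E \<longleftrightarrow> (\<forall>v w. E (mult_i v) (mult_i w) = E v w)"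

text \<open>The two equations are the real and imaginary part of E wedge dz1 wedge dz2 = 0; this
  links the Stokes computation with invariance.\<close>

lemma i_invariant_iff:
  assumes "alternating E"
  shows "i_invariant E \<longleftrightarrow> E (1, 0) (0, 1) = E (\<i>, 0) (0, \<i>) \<and> E (\<i>, 0) (0, 1) = - E (1, 0) (0, \<i>)"
    (is "_ \<longleftrightarrow> ?R")
proof
  assume inv: "i_invariant E"
  have bil: "bilinear E" using assms by (simp add: alternating_def)
  have "E (1, 0) (0, 1) = E (mult_i (1, 0)) (mult_i (0, 1))"
       "E (1, 0) (0, \<i>) = E (mult_i (1, 0)) (mult_i (0, \<i>))" using inv unfolding i_invariant_def by metis+
  moreover have "mult_i (0, \<i>) = - (0, 1)" by (simp add: mult_i_def)
  ultimately show ?R by (simp add: bilinear_rneg[OF bil] mult_i_def del: uminus_Pair)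
next
  assume ?R
  then have "E (mult_i v) (mult_i w) = E v w" for v w
    unfolding std_form_std[OF assms, of "mult_i v"] std_form_std[OF assms, of v w]
    by (simp add: std_form_def mult_i_def algebra_simps)
  then show "i_invariant E" by (simp add: i_invariant_def)
qed

lemma alternating_cdet: "alternating (\<lambda>v w. Re (cdet v w))" "alternating (\<lambda>v w. Im (cdet v w))"
  unfolding alternating_def bilinear_def
  by (auto intro!: linearI simp: cdet_def algebra_simps)

definition coords :: "C2 \<Rightarrow> C2 \<Rightarrow> C2 \<Rightarrow> C2 \<Rightarrow> C2 \<Rightarrow> C2" where
  "coords b1 b2 b3 b4 = inv_into UNIV (of_coords b1 b2 b3 b4)"

lemma
  assumes b: "lattice_basis \<Lambda> b1 b2 b3 b4"
  shows of_coords_coords: "of_coords b1 b2 b3 b4 (coords b1 b2 b3 b4 v) = v"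
    and coords_of_coords: "coords b1 b2 b3 b4 (of_coords b1 b2 b3 b4 v) = v"
    and linear_coords: "linear (coords b1 b2 b3 b4)"
    and integral_point_coords: "l \<in> \<Lambda> \<Longrightarrow> integral_point (coords b1 b2 b3 b4 l)"
proof -
  let ?c = "coords b1 b2 b3 b4" and ?o = "of_coords b1 b2 b3 b4"
  have bij: "bij ?o" using lattice_basis_bij[OF b] .
  have oc: "?o (?c v) = v" for v
    unfolding coords_def using bij by (simp add: bij_is_surj surj_f_inv_f)
  have co: "?c (?o v) = v" for v
    unfolding coords_def using bij by (simp add: bij_is_inj)
  show "?o (?c v) = v" "?c (?o v) = v" by (fact oc, fact co)
  show "linear ?c"
  proof (rule linearI)
    show "?c (v + w) = ?c v + ?c w" for v w
      using linear_add[OF linear_of_coords, of b1 b2 b3 b4 "?c v" "?c w"] oc co by metis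
    show "?c (r *\<^sub>R v) = r *\<^sub>R ?c v" for r v
      using linear_cmul[OF linear_of_coords, of b1 b2 b3 b4 r "?c v"] oc co by metis
  qed
  show "integral_point (?c l)" if "l \<in> \<Lambda>"
    using b that by (auto simp: lattice_basis_iff co)
qed

lemma alternating_coords:
  assumes "lattice_basis \<Lambda> b1 b2 b3 b4" "alternating E"
  shows "E v w = std_form (E b1 b2) (E b1 b3) (E b1 b4) (E b2 b3) (E b2 b4) (E b3 b4)
    (coords b1 b2 b3 b4 v) (coords b1 b2 b3 b4 w)"
  using alternating_of_coords[OF assms(2), of b1 b2 b3 b4 "coords b1 b2 b3 b4 v" "coords b1 b2 b3 b4 w"]
  by (simp add: of_coords_coords[OF assms(1)])

lemma alternating_eqI:
  assumes "lattice_basis \<Lambda> b1 b2 b3 b4" "alternating E" "alternating F"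
    "E b1 b2 = F b1 b2" "E b1 b3 = F b1 b3" "E b1 b4 = F b1 b4"
    "E b2 b3 = F b2 b3" "E b2 b4 = F b2 b4" "E b3 b4 = F b3 b4"
  shows "E = F"
proof (intro ext)
  show "E v w = F v w" for v w
    unfolding alternating_coords[OF assms(1,2), of v w] alternating_coords[OF assms(1,3), of v w] assms(4-) ..
qed

lemma H2_I:
  assumes b: "lattice_basis \<Lambda> b1 b2 b3 b4" and alt: "alternating E"
    and ints: "E b1 b2 \<in> \<int>" "E b1 b3 \<in> \<int>" "E b1 b4 \<in> \<int>" "E b2 b3 \<in> \<int>" "E b2 b4 \<in> \<int>" "E b3 b4 \<in> \<int>"
  shows "E \<in> H2 \<Lambda>"
proof -
  have "E l m \<in> \<int>" if "l \<in> \<Lambda>" "m \<in> \<Lambda>" for l m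
    using integral_point_coords[OF b that(1)] integral_point_coords[OF b that(2)] ints
    unfolding alternating_coords[OF b alt, of l m] std_form_def integral_point_def by auto
  then show ?thesis using alt by (simp add: H2_def alternating_def)
qed

subsection \<open>The Neron--Severi lattice as the invariant classes\<close>

theorem NS_i_invariant:
  assumes b: "lattice_basis \<Lambda> b1 b2 b3 b4" and "E \<in> NS \<Lambda>"
  shows "E \<in> H2 \<Lambda>" "i_invariant E"
proof -
  from assms(2) obtain f where H2: "E \<in> H2 \<Lambda>" and f: "\<And>l. l \<in> \<Lambda> \<Longrightarrow> holomorphic_C2 (f l)"
    "\<And>l m v. l \<in> \<Lambda> \<Longrightarrow> m \<in> \<Lambda> \<Longrightarrow> of_real (E l m) = f m (v + l) + f l v - f l (v + m) - f m v"
    unfolding NS_def chern_class_def by blast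
  show "E \<in> H2 \<Lambda>" by fact
  have alt: "alternating E" using H2 by (rule H2_alternating)
  note mem = lattice_basis_mem[OF b]
  have w: "of_real (E b1 b2) * cdet b3 b4 - of_real (E b1 b3) * cdet b2 b4 + of_real (E b1 b4) * cdet b2 b3
   + of_real (E b2 b3) * cdet b1 b4 - of_real (E b2 b4) * cdet b1 b3 + of_real (E b3 b4) * cdet b1 b2 = 0"
    by (rule Chern_class_wedge_cdet[where f = f]) (use f mem in blast)+
  have surj: "surj (of_coords b1 b2 b3 b4)" using lattice_basis_bij[OF b] by (rule bij_is_surj)
  \<comment> \<open>A 4-form that vanishes on one real basis vanishes identically; this carries the
    relation from the lattice basis to the standard one.\<close>
  have zero: "wedge E F v1 v2 v3 v4 = 0" if "alternating F" "wedge E F b1 b2 b3 b4 = 0" for F v1 v2 v3 v4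
  proof -
    obtain u1 u2 u3 u4 where "v1 = of_coords b1 b2 b3 b4 u1" "v2 = of_coords b1 b2 b3 b4 u2"
      "v3 = of_coords b1 b2 b3 b4 u3" "v4 = of_coords b1 b2 b3 b4 u4" using surj by (metis surjD)
    then show ?thesis using wedge_of_coords[OF alt that(1)] that(2) by simp
  qed
  have "wedge E (\<lambda>v w. Re (cdet v w)) b1 b2 b3 b4 = 0" "wedge E (\<lambda>v w. Im (cdet v w)) b1 b2 b3 b4 = 0"
    using arg_cong[OF w, of Re] arg_cong[OF w, of Im] by (simp_all add: wedge_def)
  from zero[OF alternating_cdet(1) this(1), of "(1, 0)" "(\<i>, 0)" "(0, 1)" "(0, \<i>)"]
    zero[OF alternating_cdet(2) this(2), of "(1, 0)" "(\<i>, 0)" "(0, 1)" "(0, \<i>)"]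
  show "i_invariant E" unfolding i_invariant_iff[OF alt] by (simp add: wedge_def cdet_def)
qed

definition hermitian_form :: "form \<Rightarrow> C2 \<Rightarrow> C2 \<Rightarrow> complex" where
  "hermitian_form E v w = Complex (E (mult_i v) w) (E v w)"

lemma hermitian_form_props:
  assumes alt: "alternating E" and inv: "i_invariant E"
  shows "hermitian_form E v w = fst v * hermitian_form E (1, 0) w + snd v * hermitian_form E (0, 1) w"
    and "hermitian_form E v (w + w') = hermitian_form E v w + hermitian_form E v w'"
    and "hermitian_form E v w - hermitian_form E w v = 2 * \<i> * of_real (E v w)"
proof -
  obtain c12 c13 c14 c34 where E: "E = std_form c12 c13 c14 (- c14) c13 c34"
    using std_form_std[OF alt] inv[unfolded i_invariant_iff[OF alt]] by (metis ext)
  show "hermitian_form E v w = fst v * hermitian_form E (1, 0) w + snd v * hermitian_form E (0, 1) w"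
    "hermitian_form E v (w + w') = hermitian_form E v w + hermitian_form E v w'"
    "hermitian_form E v w - hermitian_form E w v = 2 * \<i> * of_real (E v w)"
    by (simp_all add: E hermitian_form_def complex_eq_iff std_form_def mult_i_def algebra_simps)
qed

lemma holomorphic_C2_affine: "holomorphic_C2 (\<lambda>v. fst v * a + snd v * b + c)"
  unfolding holomorphic_C2_def
proof (intro allI exI)
  fix v :: C2
  show "((\<lambda>v. fst v * a + snd v * b + c) has_derivative (\<lambda>h. a * fst h + b * snd h)) (at v)"
    by (auto intro!: derivative_eq_intros)
qed

lemma holomorphic_C2_exp:
  assumes "holomorphic_C2 g"
  shows "holomorphic_C2 (\<lambda>v. exp (c * g v))"
  unfolding holomorphic_C2_def
proof
  fix v
  from assms obtain a b where "(g has_derivative (\<lambda>h. a * fst h + b * snd h)) (at v)"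
    unfolding holomorphic_C2_def by blast
  from has_derivative_compose[OF has_derivative_mult_right[OF this, of c] DERIV_exp[unfolded has_field_derivative_def]]
  have "((\<lambda>v. exp (c * g v)) has_derivative
    (\<lambda>h. (exp (c * g v) * c * a) * fst h + (exp (c * g v) * c * b) * snd h)) (at v)"
    by (rule has_derivative_eq_rhs) (auto simp: algebra_simps)
  then show "\<exists>a b. ((\<lambda>v. exp (c * g v)) has_derivative (\<lambda>h. a * fst h + b * snd h)) (at v)" by blast
qed

text \<open>The factor of automorphy is \<open>e l v = \<alpha> l * exp (\<pi> H v l + (\<pi>/2) H l l)\<close>, where
  \<open>\<alpha> l = exp (2 \<pi> \<i> \<rho> l)\<close> is a semicharacter for \<open>E\<close>, that is \<open>\<alpha> (l + m) = \<alpha> l * \<alpha> m * (-1)\<^bsup>E l m\<^esup>\<close>.\<close>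

theorem i_invariant_NS:
  assumes b: "lattice_basis \<Lambda> b1 b2 b3 b4" and H2: "E \<in> H2 \<Lambda>" and inv: "i_invariant E"
  shows "E \<in> NS \<Lambda>"
proof -
  have alt: "alternating E" using H2 by (rule H2_alternating)
  note herm = hermitian_form_props[OF alt inv]
  let ?H = "hermitian_form E"
  let ?pt = "coords b1 b2 b3 b4"
  have pt_add: "?pt (v + w) = ?pt v + ?pt w" for v w
    using linear_coords[OF b] by (rule linear_add)
  \<comment> \<open>The strictly upper triangular part of E in the lattice basis. It is integral on
    the lattice and E is its antisymmetrisation, so half of its diagonal values can serve as
    exponents of a semicharacter.\<close>
  define B :: form where "B = (\<lambda>v w. E b1 b2 * (Re (fst v) * Im (fst w)) + E b1 b3 * (Re (fst v) * Re (snd w))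
    + E b1 b4 * (Re (fst v) * Im (snd w)) + E b2 b3 * (Im (fst v) * Re (snd w))
    + E b2 b4 * (Im (fst v) * Im (snd w)) + E b3 b4 * (Re (snd v) * Im (snd w)))"
  have EB: "E v w = B (?pt v) (?pt w) - B (?pt w) (?pt v)" for v w
    unfolding alternating_coords[OF b alt, of v w] by (simp add: std_form_def B_def algebra_simps)
  have B_int: "B (?pt l) (?pt m) \<in> \<int>" if "l \<in> \<Lambda>" "m \<in> \<Lambda>" for l m
    using integral_point_coords[OF b that(1)] integral_point_coords[OF b that(2)] H2 lattice_basis_mem[OF b]
    unfolding B_def integral_point_def H2_def by auto
  define \<rho> where "\<rho> l = B (?pt l) (?pt l) / 2" for l
  have \<rho>: "\<rho> (l + m) = \<rho> l + \<rho> m + E l m / 2 + B (?pt m) (?pt l)" for l m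
  proof -
    have "B (?pt l + ?pt m) (?pt l + ?pt m) = B (?pt l) (?pt l) + B (?pt m) (?pt m) + B (?pt l) (?pt m) + B (?pt m) (?pt l)"
      by (simp add: B_def algebra_simps)
    then show ?thesis unfolding \<rho>_def pt_add EB[of l m] by (simp add: field_simps)
  qed
  define f where "f l v = ?H v l / (2 * \<i>) + (?H l l / (4 * \<i>) + of_real (\<rho> l))" for l v
  define e where "e l v = exp (2 * of_real pi * \<i> * f l v)" for l v
  have fhol: "holomorphic_C2 (f l)" for l
  proof -
    have "f l = (\<lambda>v. fst v * (?H (1, 0) l / (2 * \<i>)) + snd v * (?H (0, 1) l / (2 * \<i>)) +
      (?H l l / (4 * \<i>) + of_real (\<rho> l)))"
    proof
      show "f l v = fst v * (?H (1, 0) l / (2 * \<i>)) + snd v * (?H (0, 1) l / (2 * \<i>)) +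
        (?H l l / (4 * \<i>) + of_real (\<rho> l))" for v
        unfolding f_def herm(1)[of v l] by (simp add: field_simps)
    qed
    then show ?thesis by (simp only: holomorphic_C2_affine)
  qed
  have Hadd: "?H (v + v') w = ?H v w + ?H v' w" for v v' w
    unfolding herm(1)[of "v + v'" w] herm(1)[of v w] herm(1)[of v' w] by (simp add: algebra_simps)
  \<comment> \<open>The logarithms satisfy the cocycle rule up to the integer B m l, which the
    exponential removes.\<close>
  have cocycle: "f (l + m) v = f m (v + l) + f l v + of_real (B (?pt m) (?pt l))" for l m v
  proof -
    have lm: "?H l m = ?H m l + 2 * \<i> * of_real (E l m)" using herm(3)[of l m] by (simp add: algebra_simps)
    show ?thesis unfolding f_def \<rho> Hadd herm(2) lm by (simp add: field_simps)
  qed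
  have "factor_of_automorphy \<Lambda> e"
    unfolding factor_of_automorphy_def
  proof (intro conjI ballI allI)
    show "holomorphic_C2 (e l)" for l unfolding e_def by (rule holomorphic_C2_exp[OF fhol])
    show "e l v \<noteq> 0" for l v by (simp add: e_def)
    fix l m v assume lm: "l \<in> \<Lambda>" "m \<in> \<Lambda>"
    have "exp (2 * of_real pi * \<i> * complex_of_real (B (?pt m) (?pt l))) = 1"
      using exp_integer_2pi[OF B_int[OF lm(2,1)]] by (simp add: mult_ac)
    then show "e (l + m) v = e m (v + l) * e l v"
      unfolding e_def cocycle by (simp add: exp_add algebra_simps)
  qed
  moreover have "of_real (E l m) = f m (v + l) + f l v - f l (v + m) - f m v" for l m v
  proof -
    have lm: "?H l m = ?H m l + 2 * \<i> * of_real (E l m)" using herm(3)[of l m] by (simp add: algebra_simps)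
    show ?thesis unfolding f_def Hadd lm by (simp add: field_simps)
  qed
  then have "chern_class \<Lambda> e E"
    unfolding chern_class_def using H2 fhol by (auto simp: e_def intro!: exI[of _ f])
  ultimately show ?thesis unfolding NS_def by blast
qed

theorem NS_eq:
  assumes "is_lattice \<Lambda>"
  shows "NS \<Lambda> = {E \<in> H2 \<Lambda>. i_invariant E}"
  using assms NS_i_invariant i_invariant_NS unfolding is_lattice_def by blast

subsection \<open>Integral bases\<close>

definition scale_form :: "int \<Rightarrow> form \<Rightarrow> form" where
  "scale_form n E = (\<lambda>v w. of_int n * E v w)"

definition form_subgroup :: "form set \<Rightarrow> bool" where
  "form_subgroup A \<longleftrightarrow> 0 \<in> A \<and> (\<forall>E\<in>A. \<forall>F\<in>A. E - F \<in> A)"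

lemma form_subgroup_diff: "form_subgroup A \<Longrightarrow> E \<in> A \<Longrightarrow> F \<in> A \<Longrightarrow> E - F \<in> A"
  unfolding form_subgroup_def by blast

lemma form_subgroup_add:
  assumes "form_subgroup A" "E \<in> A" "F \<in> A"
  shows "E + F \<in> A"
proof -
  have "0 - F \<in> A" using assms unfolding form_subgroup_def by blast
  then have "E - (0 - F) \<in> A" using assms unfolding form_subgroup_def by blast
  then show ?thesis by simp
qed

lemma form_subgroup_scale:
  assumes A: "form_subgroup A" and E: "E \<in> A"
  shows "scale_form n E \<in> A"
proof (induction n rule: int_induct[where k = 0])
  case base
  have "scale_form 0 E = 0" by (intro ext) (simp add: scale_form_def)
  then show ?case using A unfolding form_subgroup_def by (simp only:)
next
  case (step1 i)
  have "scale_form (i + 1) E = scale_form i E + E" by (intro ext) (simp add: scale_form_def algebra_simps)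
  then show ?case using form_subgroup_add[OF A step1(2) E] by (simp only:)
next
  case (step2 i)
  have "scale_form (i - 1) E = scale_form i E - E" by (intro ext) (simp add: scale_form_def algebra_simps)
  then show ?case using form_subgroup_diff[OF A step2(2) E] by (simp only:)
qed

lemma additive_scale:
  fixes c :: "form \<Rightarrow> int"
  assumes A: "form_subgroup A" and c: "\<And>E F. E \<in> A \<Longrightarrow> F \<in> A \<Longrightarrow> c (E - F) = c E - c F" and E: "E \<in> A"
  shows "c (scale_form n E) = n * c E"
proof -
  have c0: "c 0 = 0" using c[of 0 0] A by (simp add: form_subgroup_def)
  show ?thesis
  proof (induction n rule: int_induct[where k = 0])
    case base
    have "scale_form 0 E = 0" by (intro ext) (simp add: scale_form_def)
    then show ?case using c0 by (simp only: mult_zero_left)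
  next
    case (step1 i)
    have "scale_form i E = scale_form (i + 1) E - E" by (intro ext) (simp add: scale_form_def algebra_simps)
    then have "c (scale_form i E) = c (scale_form (i + 1) E) - c E"
      using c form_subgroup_scale[OF A E] E by metis
    then show ?case using step1 by (simp add: algebra_simps)
  next
    case (step2 i)
    have "scale_form (i - 1) E = scale_form i E - E" by (intro ext) (simp add: scale_form_def algebra_simps)
    then have "c (scale_form (i - 1) E) = c (scale_form i E) - c E"
      using c form_subgroup_scale[OF A E] E by metis
    then show ?case using step2 by (simp add: algebra_simps)
  qed
qed

lemma int_comb_Cons: "int_comb k (E # Bs) = scale_form (k 0) E + int_comb (k \<circ> Suc) Bs"
  by (intro ext) (simp add: int_comb_def scale_form_def sum.lessThan_Suc_shift del: sum.lessThan_Suc)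

text \<open>A subgroup of a free abelian group of finite rank is free: split off a generator of the
  image under one coordinate and recurse into the kernel.\<close>

lemma int_basis_exists:
  fixes cs :: "(form \<Rightarrow> int) list"
  assumes "form_subgroup A" "\<And>c E F. c \<in> set cs \<Longrightarrow> E \<in> A \<Longrightarrow> F \<in> A \<Longrightarrow> c (E - F) = c E - c F"
    and "\<And>E. E \<in> A \<Longrightarrow> (\<And>c. c \<in> set cs \<Longrightarrow> c E = 0) \<Longrightarrow> E = 0"
  shows "\<exists>Bs. int_basis A Bs"
  using assms
proof (induction cs arbitrary: A)
  case Nil
  then have "A = {0}" unfolding form_subgroup_def by (metis empty_iff empty_set is_singletonI' is_singleton_the_elem singletonD)
  moreover have "int_comb c [] = 0" for c by (intro ext) (simp add: int_comb_def)
  ultimately have "int_basis A []" by (auto simp: int_basis_def)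
  then show ?case ..
next
  case (Cons c cs)
  define K where "K = {E \<in> A. c E = 0}"
  have sub: "form_subgroup A" by fact
  have c: "c (E - F) = c E - c F" if "E \<in> A" "F \<in> A" for E F
    using that by (rule Cons.prems(2)[OF list.set_intros(1)])
  have c0: "c 0 = 0" using c[of 0 0] sub by (simp add: form_subgroup_def)
  have K: "form_subgroup K" using sub c c0 by (auto simp: form_subgroup_def K_def)
  obtain Bs where Bs: "int_basis K Bs"
  proof -
    have "\<exists>Bs. int_basis K Bs"
    proof (rule Cons.IH[OF K])
      show "d (E - F) = d E - d F" if "d \<in> set cs" "E \<in> K" "F \<in> K" for d E F
        using Cons.prems(2)[OF list.set_intros(2), OF that(1)] that(2,3) unfolding K_def by blast
      show "E = 0" if "E \<in> K" "\<And>d. d \<in> set cs \<Longrightarrow> d E = 0" for E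
        using Cons.prems(3)[of E] that unfolding K_def by (metis (mono_tags, lifting) mem_Collect_eq set_ConsD)
    qed
    then show ?thesis using that by blast
  qed
  show ?case
  proof (cases "\<exists>E\<in>A. c E \<noteq> 0")
    case False
    then have "K = A" by (auto simp: K_def)
    then show ?thesis using Bs by blast
  next
    case True
    then obtain E1 where E1: "E1 \<in> A" "c E1 \<noteq> 0" by blast
    have cs: "c (scale_form n E) = n * c E" if "E \<in> A" for n E
      by (rule additive_scale[OF sub _ that]) (rule c)
    \<comment> \<open>The least positive value of c generates its image, since the remainder of a
      division by it would be a smaller value.\<close>
    define P where "P n \<longleftrightarrow> n > 0 \<and> (\<exists>E\<in>A. c E = int n)" for n
    have "\<exists>E\<in>A. c E = \<bar>c E1\<bar>"
      using E1 cs[OF E1(1), of "sgn (c E1)"] form_subgroup_scale[OF sub E1(1), of "sgn (c E1)"]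
      by (metis abs_sgn mult.commute)
    then have "P (nat \<bar>c E1\<bar>)" using E1 by (auto simp: P_def)
    then have L: "P (Least P)" by (rule LeastI)
    then obtain E0 where E0: "E0 \<in> A" "c E0 = int (Least P)" by (auto simp: P_def)
    have pos: "c E0 > 0" using L E0 by (simp add: P_def)
    have step: "E - scale_form (c E div c E0) E0 \<in> K" if E: "E \<in> A" for E
    proof -
      define R where "R = E - scale_form (c E div c E0) E0"
      have R: "R \<in> A"
        unfolding R_def by (rule form_subgroup_diff[OF sub E form_subgroup_scale[OF sub E0(1)]])
      have "c R = c E - c E div c E0 * c E0"
        unfolding R_def c[OF E form_subgroup_scale[OF sub E0(1)]] cs[OF E0(1)] ..
      then have cR: "c R = c E mod c E0" by (simp add: minus_div_mult_eq_mod)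
      have "c R = 0"
      proof (rule ccontr)
        assume "c R \<noteq> 0"
        moreover have "0 \<le> c R" "c R < c E0" unfolding cR using pos by simp_all
        ultimately have "P (nat (c R))" "nat (c R) < Least P" using R E0(2) by (auto simp: P_def)
        then show False using not_less_Least by blast
      qed
      then show ?thesis using R unfolding K_def R_def by blast
    qed
    have KB: "K = range (\<lambda>k. int_comb k Bs)" and ind: "\<And>k. int_comb k Bs = 0 \<Longrightarrow> \<forall>i<length Bs. k i = 0"
      using Bs by (auto simp: int_basis_def)
    have "int_basis A (E0 # Bs)"
      unfolding int_basis_def
    proof (intro conjI allI impI)
      show "A = range (\<lambda>k. int_comb k (E0 # Bs))"
      proof
        show "A \<subseteq> range (\<lambda>k. int_comb k (E0 # Bs))"
        proof
          fix E assume "E \<in> A"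
          from step[OF this] obtain k where k: "E - scale_form (c E div c E0) E0 = int_comb k Bs"
            using KB by blast
          have "E = int_comb (case_nat (c E div c E0) k) (E0 # Bs)"
            unfolding int_comb_Cons by (simp add: o_def k[symmetric])
          then show "E \<in> range (\<lambda>k. int_comb k (E0 # Bs))" by blast
        qed
        show "range (\<lambda>k. int_comb k (E0 # Bs)) \<subseteq> A"
        proof (rule image_subsetI)
          fix k
          have "int_comb (k \<circ> Suc) Bs \<in> A" using KB by (auto simp: K_def)
          then show "int_comb k (E0 # Bs) \<in> A"
            unfolding int_comb_Cons using form_subgroup_add[OF sub form_subgroup_scale[OF sub E0(1)]] by blast
        qed
      qed
      fix k i assume k: "int_comb k (E0 # Bs) = 0" and i: "i < length (E0 # Bs)"
      have m: "int_comb (k \<circ> Suc) Bs \<in> K" using KB by blast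
      have "0 - int_comb (k \<circ> Suc) Bs = scale_form (k 0) E0"
        using k unfolding int_comb_Cons diff_0 by (metis minus_unique add.commute)
      moreover have "0 \<in> A" "int_comb (k \<circ> Suc) Bs \<in> A" "c (int_comb (k \<circ> Suc) Bs) = 0"
        using m sub unfolding K_def form_subgroup_def by blast+
      ultimately have "c (scale_form (k 0) E0) = 0" using c c0 by (metis diff_0 neg_0_equal_iff_equal)
      then have "k 0 * c E0 = 0" unfolding cs[OF E0(1)] .
      then have k0: "k 0 = 0" using pos by simp
      moreover have "scale_form 0 E0 = 0" by (intro ext) (simp add: scale_form_def)
      ultimately have "int_comb (k \<circ> Suc) Bs = 0" using k unfolding int_comb_Cons by simp
      then show "k i = 0" using ind[of "k \<circ> Suc"] k0 i by (cases i) auto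
    qed
    then show ?thesis ..
  qed
qed

lemma int_basis_pair:
  "int_basis A [E, F] \<longleftrightarrow> A = range (\<lambda>(x, y). scale_form x E + scale_form y F) \<and>
     (\<forall>x y. scale_form x E + scale_form y F = 0 \<longrightarrow> x = 0 \<and> y = 0)"
proof -
  have comb: "int_comb k [E, F] = scale_form (k 0) E + scale_form (k 1) F" for k
  proof -
    have "int_comb j [] = 0" for j by (intro ext) (simp add: int_comb_def)
    then show ?thesis by (simp add: int_comb_Cons)
  qed
  have "range (\<lambda>k. int_comb k [E, F]) = range (\<lambda>(x, y). scale_form x E + scale_form y F)"
  proof
    show "range (\<lambda>(x, y). scale_form x E + scale_form y F) \<subseteq> range (\<lambda>k. int_comb k [E, F])"
    proof (rule image_subsetI)
      fix p :: "int \<times> int"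
      have "(case p of (x, y) \<Rightarrow> scale_form x E + scale_form y F) =
        int_comb (\<lambda>i. if i = 0 then fst p else snd p) [E, F]"
        unfolding comb by (simp add: case_prod_unfold)
      then show "(case p of (x, y) \<Rightarrow> scale_form x E + scale_form y F) \<in> range (\<lambda>k. int_comb k [E, F])"
        by blast
    qed
  qed (auto simp: comb)
  moreover have "(\<forall>k. int_comb k [E, F] = 0 \<longrightarrow> (\<forall>i<length [E, F]. k i = 0)) \<longleftrightarrow>
    (\<forall>x y. scale_form x E + scale_form y F = 0 \<longrightarrow> x = 0 \<and> y = 0)" (is "?A \<longleftrightarrow> ?B")
  proof
    assume ?A
    show ?B
    proof (intro allI impI)
      fix x y assume "scale_form x E + scale_form y F = 0"
      then have "int_comb (\<lambda>i. if i = 0 then x else y) [E, F] = 0" unfolding comb by simp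
      with \<open>?A\<close> have "\<forall>i<length [E, F]. (if i = 0 then x else y) = 0" by blast
      from spec[OF this, of 0] spec[OF this, of 1] show "x = 0 \<and> y = 0" by simp
    qed
  next
    assume ?B then show ?A unfolding comb by (auto simp: less_Suc_eq)
  qed
  ultimately show ?thesis unfolding int_basis_def by (simp only:)
qed

text \<open>The rows (x, y) and (-w, u) form a matrix of determinant x u + y w; \<open>inv\<close>
  and \<open>surj\<close> are the formulas for its inverse.\<close>

lemma int_basis_unimodular:
  assumes "int_basis A [E, F]" "x * u + y * w = 1"
  shows "int_basis A [scale_form x E + scale_form y F, scale_form (- w) E + scale_form u F]"
proof -
  let ?L = "scale_form x E + scale_form y F" and ?M = "scale_form (- w) E + scale_form u F"
  have A: "A = range (\<lambda>(x, y). scale_form x E + scale_form y F)"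
    and ind: "\<And>x y. scale_form x E + scale_form y F = 0 \<Longrightarrow> x = 0 \<and> y = 0"
    using assms(1) unfolding int_basis_pair by blast+
  have comb: "scale_form i ?L + scale_form j ?M = scale_form (i * x - j * w) E + scale_form (i * y + j * u) F" for i j
    by (intro ext) (simp add: scale_form_def algebra_simps)
  have inv: "i = u * (i * x - j * w) + w * (i * y + j * u)" "j = x * (i * y + j * u) - y * (i * x - j * w)" for i j
  proof -
    have "u * (i * x - j * w) + w * (i * y + j * u) = i * (x * u + y * w)"
      "x * (i * y + j * u) - y * (i * x - j * w) = j * (x * u + y * w)" by (simp_all add: algebra_simps)
    then show "i = u * (i * x - j * w) + w * (i * y + j * u)" "j = x * (i * y + j * u) - y * (i * x - j * w)"
      using assms(2) by simp_all
  qed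
  have surj: "k = (u * k + w * l) * x - (x * l - y * k) * w" "l = (u * k + w * l) * y + (x * l - y * k) * u" for k l
  proof -
    have "(u * k + w * l) * x - (x * l - y * k) * w = k * (x * u + y * w)"
      "(u * k + w * l) * y + (x * l - y * k) * u = l * (x * u + y * w)" by (simp_all add: algebra_simps)
    then show "k = (u * k + w * l) * x - (x * l - y * k) * w" "l = (u * k + w * l) * y + (x * l - y * k) * u"
      using assms(2) by simp_all
  qed
  show ?thesis
    unfolding int_basis_pair
  proof (intro conjI allI impI)
    show "A = range (\<lambda>(i, j). scale_form i ?L + scale_form j ?M)"
    proof
      show "A \<subseteq> range (\<lambda>(i, j). scale_form i ?L + scale_form j ?M)"
      proof
        fix B assume "B \<in> A"
        then obtain k l where "B = scale_form k E + scale_form l F" using A by auto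
        then have "B = scale_form (u * k + w * l) ?L + scale_form (x * l - y * k) ?M"
          unfolding comb surj(1)[where k = k and l = l, symmetric] surj(2)[where k = k and l = l, symmetric] .
        then show "B \<in> range (\<lambda>(i, j). scale_form i ?L + scale_form j ?M)"
          by (intro image_eqI[of _ _ "(u * k + w * l, x * l - y * k)"]) auto
      qed
      show "range (\<lambda>(i, j). scale_form i ?L + scale_form j ?M) \<subseteq> A"
        unfolding A comb by auto
    qed
    fix i j assume "scale_form i ?L + scale_form j ?M = 0"
    from ind[OF this[unfolded comb]] inv[where i = i and j = j] show "i = 0" "j = 0" by auto
  qed
qed

lemma det_2:
  fixes A :: "'a::comm_ring_1 mat"
  assumes "A \<in> carrier_mat 2 2"
  shows "Determinant.det A = A $$ (0, 0) * A $$ (1, 1) - A $$ (0, 1) * A $$ (1, 0)"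
proof -
  have "mat_delete A 0 j \<in> carrier_mat 1 1" for j
    using mat_delete_carrier[OF assms, of 0 j] by simp
  then have d: "Determinant.det (mat_delete A 0 j) = mat_delete A 0 j $$ (0, 0)" for j by (rule det_single)
  have "mat_delete A 0 0 $$ (0, 0) = A $$ (1, 1)" "mat_delete A 0 1 $$ (0, 0) = A $$ (1, 0)"
    using assms by (auto simp: mat_delete_def)
  then have "cofactor A 0 0 = A $$ (1, 1)" "cofactor A 0 1 = - A $$ (1, 0)"
    by (simp_all add: cofactor_def d)
  moreover have "{..<2} = {0, 1::nat}" by auto
  ultimately show ?thesis
    using laplace_expansion_row[OF assms, of 0] by simp
qed

lemma alternating_diff:
  assumes "alternating E" "alternating F"
  shows "alternating (E - F)"
  using assms unfolding alternating_def bilinear_def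
  by (simp add: fun_diff_def linear_compose_sub del: split_paired_All)

lemma form_subgroup_H2:
  assumes "lattice_basis \<Lambda> b1 b2 b3 b4"
  shows "form_subgroup (H2 \<Lambda>)"
proof -
  have "0 \<in> H2 \<Lambda>" by (auto simp: H2_def bilinear_def intro!: linearI)
  moreover have "E - F \<in> H2 \<Lambda>" if "E \<in> H2 \<Lambda>" "F \<in> H2 \<Lambda>" for E F
  proof -
    have "alternating (E - F)" using that by (intro alternating_diff H2_alternating)
    then show ?thesis using that by (simp add: H2_def alternating_def)
  qed
  ultimately show ?thesis by (simp add: form_subgroup_def)
qed

lemma form_subgroup_NS:
  assumes b: "lattice_basis \<Lambda> b1 b2 b3 b4"
  shows "form_subgroup (NS \<Lambda>)"
proof -
  have lat: "is_lattice \<Lambda>" unfolding is_lattice_def using b by blast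
  have "0 \<in> H2 \<Lambda>" "\<And>E F. E \<in> H2 \<Lambda> \<Longrightarrow> F \<in> H2 \<Lambda> \<Longrightarrow> E - F \<in> H2 \<Lambda>"
    using form_subgroup_H2[OF b] by (auto simp: form_subgroup_def)
  then show ?thesis unfolding form_subgroup_def NS_eq[OF lat] by (auto simp: i_invariant_def)
qed

text \<open>\<open>NS_basis\<close> is a choice, so existence is the point: the six values on pairs
  of basis vectors are integral and determine a class. \<open>floor\<close> merely types them as
  integers.\<close>

lemma int_basis_NS_basis:
  assumes b: "lattice_basis \<Lambda> b1 b2 b3 b4"
  shows "int_basis (NS \<Lambda>) (NS_basis \<Lambda>)"
proof -
  have H2: "E \<in> H2 \<Lambda>" if "E \<in> NS \<Lambda>" for E using NS_i_invariant(1)[OF b that] .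
  note mem = lattice_basis_mem[OF b]
  let ?cs = "[\<lambda>E :: form. \<lfloor>E b1 b2\<rfloor>, \<lambda>E. \<lfloor>E b1 b3\<rfloor>, \<lambda>E. \<lfloor>E b1 b4\<rfloor>, \<lambda>E. \<lfloor>E b2 b3\<rfloor>, \<lambda>E. \<lfloor>E b2 b4\<rfloor>, \<lambda>E. \<lfloor>E b3 b4\<rfloor>]"
  have fl: "real_of_int \<lfloor>E l m\<rfloor> = E l m" if "E \<in> NS \<Lambda>" "l \<in> \<Lambda>" "m \<in> \<Lambda>" for E l m
    using H2[OF that(1)] that(2,3) unfolding H2_def by (auto elim!: Ints_cases dest!: bspec)
  have "\<exists>Bs. int_basis (NS \<Lambda>) Bs"
  proof (rule int_basis_exists[OF form_subgroup_NS[OF b], of ?cs])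
    fix c :: "form \<Rightarrow> int" and E F assume c: "c \<in> set ?cs" and EF: "E \<in> NS \<Lambda>" "F \<in> NS \<Lambda>"
    from c obtain l m where lm: "c = (\<lambda>E. \<lfloor>E l m\<rfloor>)" "l \<in> \<Lambda>" "m \<in> \<Lambda>"
      unfolding set_simps insert_iff empty_iff using mem by blast
    have "(E - F) l m = of_int (\<lfloor>E l m\<rfloor> - \<lfloor>F l m\<rfloor>)"
      unfolding fun_diff_def of_int_diff fl[OF EF(1) lm(2,3)] fl[OF EF(2) lm(2,3)] ..
    then show "c (E - F) = c E - c F" unfolding lm(1) by (metis floor_of_int)
  next
    fix E assume E: "E \<in> NS \<Lambda>" and z: "\<And>c. c \<in> set ?cs \<Longrightarrow> c E = 0"
    have alt: "alternating E" using H2[OF E] by (rule H2_alternating)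
    have alt0: "alternating 0" by (auto simp: alternating_def bilinear_def intro!: linearI)
    have "E l m = 0" if "(\<lambda>E. \<lfloor>E l m\<rfloor>) \<in> set ?cs" "l \<in> \<Lambda>" "m \<in> \<Lambda>" for l m
      using fl[OF E that(2,3)] z[OF that(1)] by simp
    then show "E = 0" by (intro alternating_eqI[OF b alt alt0]) (simp_all add: mem)
  qed
  then show ?thesis unfolding NS_basis_def by (rule someI_ex)
qed

subsection \<open>The polarized surface\<close>

text \<open>Reversed Cauchy-Schwarz inequality in signature (1,3). Subtracting t times the first
  vector from the second kills one coordinate without changing the difference of the two sides,
  which becomes a square plus a positive multiple of a sum of two squares.\<close>

lemma Hodge_index_std:
  fixes c12 c13 c14 c34 d12 d13 d14 d34 :: real
  defines "W a b c d e f g h \<equiv> a * h + d * e - 2 * b * f - 2 * c * g"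
  assumes pos: "c12 \<noteq> 0" "c12 * c34 - c13\<^sup>2 - c14\<^sup>2 > 0"
    and indep: "\<And>t. \<not> (d12 = t * c12 \<and> d13 = t * c13 \<and> d14 = t * c14 \<and> d34 = t * c34)"
  shows "(W c12 c13 c14 c34 d12 d13 d14 d34)\<^sup>2 >
    W c12 c13 c14 c34 c12 c13 c14 c34 * W d12 d13 d14 d34 d12 d13 d14 d34"
proof -
  define t where "t = d12 / c12"
  have d12: "d12 = t * c12" using pos by (simp add: t_def)
  define n13 n14 n34 where n: "n13 = d13 - t * c13" "n14 = d14 - t * c14" "n34 = d34 - t * c34"
  have d: "d13 = t * c13 + n13" "d14 = t * c14 + n14" "d34 = t * c34 + n34" by (simp_all add: n)
  have id: "(W c12 c13 c14 c34 d12 d13 d14 d34)\<^sup>2 -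
      W c12 c13 c14 c34 c12 c13 c14 c34 * W d12 d13 d14 d34 d12 d13 d14 d34
    = (c12 * n34 - 2 * c13 * n13 - 2 * c14 * n14)\<^sup>2 + 4 * (c12 * c34 - c13\<^sup>2 - c14\<^sup>2) * (n13\<^sup>2 + n14\<^sup>2)"
    unfolding W_def d12 d by (simp add: power2_eq_square algebra_simps)
  show ?thesis
  proof (cases "n13 = 0 \<and> n14 = 0")
    case True
    then have "n34 \<noteq> 0" using indep[of t] d12 d by auto
    then have "(c12 * n34 - 2 * c13 * n13 - 2 * c14 * n14)\<^sup>2 > 0" using True pos by simp
    moreover have "4 * (c12 * c34 - c13\<^sup>2 - c14\<^sup>2) * (n13\<^sup>2 + n14\<^sup>2) = 0" using True by simp
    ultimately show ?thesis using id by linarith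
  next
    case False
    then have "n13\<^sup>2 + n14\<^sup>2 > 0" by (simp add: sum_power2_gt_zero_iff)
    then have "4 * (c12 * c34 - c13\<^sup>2 - c14\<^sup>2) * (n13\<^sup>2 + n14\<^sup>2) > 0" using pos by simp
    then show ?thesis using id zero_le_power2[of "c12 * n34 - 2 * c13 * n13 - 2 * c14 * n14"] by linarith
  qed
qed

lemma positive_i_invariant:
  assumes pos: "\<And>v. v \<noteq> 0 \<Longrightarrow> L (mult_i v) v > 0"
    and L: "L = std_form c12 c13 c14 (- c14) c13 c34"
  shows "c12 < 0" "c12 * c34 - c13\<^sup>2 - c14\<^sup>2 > 0"
proof -
  show c12: "c12 < 0" using pos[of "(1, 0)"] by (simp add: L std_form_def mult_i_def zero_prod_def)
  \<comment> \<open>This vector is orthogonal to (1, 0) for the Hermitian form of L, so its norm is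
    the determinant times a positive factor.\<close>
  have "0 < L (mult_i (Complex c14 c13, of_real (- c12))) (Complex c14 c13, of_real (- c12))"
    using c12 by (intro pos) (simp add: zero_prod_def)
  also have "\<dots> = (- c12) * (c12 * c34 - c13\<^sup>2 - c14\<^sup>2)"
    by (simp add: L std_form_def mult_i_def power2_eq_square algebra_simps)
  finally show "c12 * c34 - c13\<^sup>2 - c14\<^sup>2 > 0"
    using c12 by (metis neg_0_less_iff_less zero_less_mult_pos)
qed

lemma wedge_basis_std:
  assumes "alternating E" "alternating F"
  shows "wedge E F b1 b2 b3 b4 = volume b1 b2 b3 b4 * wedge E F (1, 0) (\<i>, 0) (0, 1) (0, \<i>)"
  using wedge_of_coords[OF assms, of "(1, 0)" "(\<i>, 0)" "(0, 1)" "(0, \<i>)" b1 b2 b3 b4]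
  by (simp only: of_coords_std)

lemma wedge_commute: "wedge E F v1 v2 v3 v4 = wedge F E v1 v2 v3 v4"
  by (simp add: wedge_def)

lemma wedge_add_left: "wedge (E + E') F v1 v2 v3 v4 = wedge E F v1 v2 v3 v4 + wedge E' F v1 v2 v3 v4"
  by (simp add: wedge_def algebra_simps)

lemma wedge_scale_left: "wedge (scale_form n E) F v1 v2 v3 v4 = of_int n * wedge E F v1 v2 v3 v4"
  by (simp add: wedge_def scale_form_def algebra_simps)

locale principally_polarized_torus =
  fixes \<Lambda> :: "C2 set" and L :: form and b1 b2 b3 b4 :: C2
  assumes basis: "lattice_basis \<Lambda> b1 b2 b3 b4" and pol: "polarization \<Lambda> L"
    and L_values: "L b1 b3 = 1" "L b2 b4 = 1" "L b1 b2 = 0" "L b1 b4 = 0" "L b2 b3 = 0" "L b3 b4 = 0"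
begin

lemma NS_iff: "E \<in> NS \<Lambda> \<longleftrightarrow> E \<in> H2 \<Lambda> \<and> i_invariant E"
proof -
  have "is_lattice \<Lambda>" unfolding is_lattice_def using basis by blast
  then show ?thesis by (simp add: NS_eq)
qed

lemma L_NS: "L \<in> NS \<Lambda>" using pol by (simp add: polarization_def)

lemma NS_H2: "E \<in> NS \<Lambda> \<Longrightarrow> E \<in> H2 \<Lambda>" by (simp add: NS_iff)

lemma NS_alternating: "E \<in> NS \<Lambda> \<Longrightarrow> alternating E"
  by (rule H2_alternating[OF NS_H2])

lemma NS_std:
  assumes "E \<in> NS \<Lambda>"
  obtains c12 c13 c14 c34 where "E = std_form c12 c13 c14 (- c14) c13 c34"
proof -
  have alt: "alternating E" and "i_invariant E" using assms NS_alternating NS_iff by auto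
  then show ?thesis using std_form_std[OF alt] that unfolding i_invariant_iff[OF alt] by (metis ext)
qed

lemma wedge_std_std:
  "wedge (std_form c12 c13 c14 (- c14) c13 c34) (std_form d12 d13 d14 (- d14) d13 d34)
     (1, 0) (\<i>, 0) (0, 1) (0, \<i>) = c12 * d34 + c34 * d12 - 2 * c13 * d13 - 2 * c14 * d14"
  unfolding wedge_std_form volume_std by simp

lemma L_std:
  obtains c12 c13 c14 c34 where "L = std_form c12 c13 c14 (- c14) c13 c34"
    "c12 < 0" "c12 * c34 - c13\<^sup>2 - c14\<^sup>2 > 0"
proof -
  obtain c12 c13 c14 c34 where c: "L = std_form c12 c13 c14 (- c14) c13 c34" using NS_std[OF L_NS] .
  have pos: "L (mult_i v) v > 0" if "v \<noteq> 0" for v using pol that unfolding polarization_def by blast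
  show ?thesis using that[OF c] positive_i_invariant[OF pos c] by blast
qed

text \<open>In the order b1, b2, b3, b4 the symplectic basis gives L wedge L the value -2, while
  positivity of L makes it positive for the complex orientation. Hence the minus sign in all later
  intersection formulas.\<close>

lemma volume_basis_neg: "volume b1 b2 b3 b4 < 0"
proof -
  obtain c12 c13 c14 c34 where c: "L = std_form c12 c13 c14 (- c14) c13 c34"
    "c12 * c34 - c13\<^sup>2 - c14\<^sup>2 > 0" using L_std .
  have "wedge L L (1, 0) (\<i>, 0) (0, 1) (0, \<i>) = 2 * (c12 * c34 - c13\<^sup>2 - c14\<^sup>2)"
    unfolding c(1) wedge_std_std by (simp add: power2_eq_square algebra_simps)
  then have pos: "wedge L L (1, 0) (\<i>, 0) (0, 1) (0, \<i>) > 0" using c(2) by simp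
  have "wedge L L b1 b2 b3 b4 = -2" by (simp add: wedge_def L_values)
  moreover have "wedge L L b1 b2 b3 b4 = volume b1 b2 b3 b4 * wedge L L (1, 0) (\<i>, 0) (0, 1) (0, \<i>)"
    by (rule wedge_basis_std[OF NS_alternating[OF L_NS] NS_alternating[OF L_NS]])
  ultimately have "volume b1 b2 b3 b4 * wedge L L (1, 0) (\<i>, 0) (0, 1) (0, \<i>) < 0" by simp
  then show ?thesis using pos by (simp add: mult_less_0_iff)
qed

lemma intersection_wedge:
  assumes "E \<in> H2 \<Lambda>" "F \<in> H2 \<Lambda>"
  shows "of_int (intersection \<Lambda> E F) = - wedge E F b1 b2 b3 b4"
  using intersection_eq[OF basis assms] volume_basis_neg by simp

lemma H2_add: "E \<in> H2 \<Lambda> \<Longrightarrow> F \<in> H2 \<Lambda> \<Longrightarrow> E + F \<in> H2 \<Lambda>"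
  by (rule form_subgroup_add[OF form_subgroup_H2[OF basis]])

lemma H2_scale: "E \<in> H2 \<Lambda> \<Longrightarrow> scale_form n E \<in> H2 \<Lambda>"
  by (rule form_subgroup_scale[OF form_subgroup_H2[OF basis]])

lemma intersection_commute:
  assumes "E \<in> H2 \<Lambda>" "F \<in> H2 \<Lambda>"
  shows "intersection \<Lambda> E F = intersection \<Lambda> F E"
proof -
  have "real_of_int (intersection \<Lambda> E F) = of_int (intersection \<Lambda> F E)"
    unfolding intersection_wedge[OF assms] intersection_wedge[OF assms(2,1)]
    by (simp only: wedge_commute)
  then show ?thesis by (simp only: of_int_eq_iff)
qed

lemma intersection_add_left:
  assumes "E \<in> H2 \<Lambda>" "E' \<in> H2 \<Lambda>" "F \<in> H2 \<Lambda>"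
  shows "intersection \<Lambda> (E + E') F = intersection \<Lambda> E F + intersection \<Lambda> E' F"
proof -
  have "real_of_int (intersection \<Lambda> (E + E') F) = of_int (intersection \<Lambda> E F + intersection \<Lambda> E' F)"
    unfolding of_int_add intersection_wedge[OF assms(1,3)] intersection_wedge[OF assms(2,3)]
      intersection_wedge[OF H2_add[OF assms(1,2)] assms(3)] wedge_add_left by simp
  then show ?thesis by (simp only: of_int_eq_iff)
qed

lemma intersection_scale_left:
  assumes "E \<in> H2 \<Lambda>" "F \<in> H2 \<Lambda>"
  shows "intersection \<Lambda> (scale_form n E) F = n * intersection \<Lambda> E F"
proof -
  have "real_of_int (intersection \<Lambda> (scale_form n E) F) = of_int (n * intersection \<Lambda> E F)"
    unfolding of_int_mult intersection_wedge[OF assms]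
      intersection_wedge[OF H2_scale[OF assms(1)] assms(2)] wedge_scale_left by simp
  then show ?thesis by (simp only: of_int_eq_iff)
qed

lemma intersection_comb_left:
  assumes "E \<in> H2 \<Lambda>" "F \<in> H2 \<Lambda>" "G \<in> H2 \<Lambda>"
  shows "intersection \<Lambda> (scale_form x E + scale_form y F) G = x * intersection \<Lambda> E G + y * intersection \<Lambda> F G"
  using assms by (simp only: intersection_add_left intersection_scale_left H2_scale)

lemma intersection_comb_comb:
  assumes EF: "E \<in> H2 \<Lambda>" "F \<in> H2 \<Lambda>"
  shows "intersection \<Lambda> (scale_form x E + scale_form y F) (scale_form x' E + scale_form y' F) =
    x * x' * intersection \<Lambda> E E + (x * y' + y * x') * intersection \<Lambda> E F + y * y' * intersection \<Lambda> F F"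
proof -
  have C: "scale_form x' E + scale_form y' F \<in> H2 \<Lambda>" using EF by (intro H2_add H2_scale)
  show ?thesis
    unfolding intersection_comb_left[OF EF C] intersection_commute[OF EF(1) C] intersection_commute[OF EF(2) C]
      intersection_comb_left[OF EF EF(1)] intersection_comb_left[OF EF EF(2)] intersection_commute[OF EF(2,1)]
    by (simp add: algebra_simps)
qed

lemma sym_biadditive_intersection: "sym_biadditive (H2 \<Lambda>) (intersection \<Lambda>)"
  unfolding sym_biadditive_def
  by (intro conjI ballI) (rule H2_add intersection_commute intersection_add_left; assumption)+

lemma H2_values_int:
  assumes "E \<in> H2 \<Lambda>"
  obtains x12 x13 x14 x23 x24 x34 :: int where
    "E b1 b2 = of_int x12" "E b1 b3 = of_int x13" "E b1 b4 = of_int x14"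
    "E b2 b3 = of_int x23" "E b2 b4 = of_int x24" "E b3 b4 = of_int x34"
proof -
  have "E l m \<in> \<int>" if "l \<in> \<Lambda>" "m \<in> \<Lambda>" for l m using assms that unfolding H2_def by blast
  note ints = this
  note mem = lattice_basis_mem[OF basis]
  obtain x12 where "E b1 b2 = of_int x12" using ints[OF mem(1,2)] by (rule Ints_cases)
  moreover obtain x13 where "E b1 b3 = of_int x13" using ints[OF mem(1,3)] by (rule Ints_cases)
  moreover obtain x14 where "E b1 b4 = of_int x14" using ints[OF mem(1,4)] by (rule Ints_cases)
  moreover obtain x23 where "E b2 b3 = of_int x23" using ints[OF mem(2,3)] by (rule Ints_cases)
  moreover obtain x24 where "E b2 b4 = of_int x24" using ints[OF mem(2,4)] by (rule Ints_cases)
  moreover obtain x34 where "E b3 b4 = of_int x34" using ints[OF mem(3,4)] by (rule Ints_cases)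
  ultimately show ?thesis by (rule that)
qed

lemma intersection_values:
  assumes "E \<in> H2 \<Lambda>" "F \<in> H2 \<Lambda>"
    and "E b1 b2 = of_int x12" "E b1 b3 = of_int x13" "E b1 b4 = of_int x14"
      "E b2 b3 = of_int x23" "E b2 b4 = of_int x24" "E b3 b4 = of_int x34"
    and "F b1 b2 = of_int y12" "F b1 b3 = of_int y13" "F b1 b4 = of_int y14"
      "F b2 b3 = of_int y23" "F b2 b4 = of_int y24" "F b3 b4 = of_int y34"
  shows "intersection \<Lambda> E F = - (x12 * y34 - x13 * y24 + x14 * y23 + x23 * y14 - x24 * y13 + x34 * y12)"
proof -
  have "real_of_int (intersection \<Lambda> E F) =
    of_int (- (x12 * y34 - x13 * y24 + x14 * y23 + x23 * y14 - x24 * y13 + x34 * y12))"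
    unfolding intersection_wedge[OF assms(1,2)] wedge_def assms(3-) by simp
  then show ?thesis by (simp only: of_int_eq_iff)
qed

definition of_ints :: "int \<Rightarrow> int \<Rightarrow> int \<Rightarrow> int \<Rightarrow> int \<Rightarrow> int \<Rightarrow> form" where
  "of_ints x12 x13 x14 x23 x24 x34 v w =
    std_form (of_int x12) (of_int x13) (of_int x14) (of_int x23) (of_int x24) (of_int x34)
      (coords b1 b2 b3 b4 v) (coords b1 b2 b3 b4 w)"

lemma coords_basis: "coords b1 b2 b3 b4 b1 = (1, 0)" "coords b1 b2 b3 b4 b2 = (\<i>, 0)"
  "coords b1 b2 b3 b4 b3 = (0, 1)" "coords b1 b2 b3 b4 b4 = (0, \<i>)"
  using coords_of_coords[OF basis] of_coords_units by metis+

lemma of_ints_values: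
  "of_ints x12 x13 x14 x23 x24 x34 b1 b2 = of_int x12" "of_ints x12 x13 x14 x23 x24 x34 b1 b3 = of_int x13"
  "of_ints x12 x13 x14 x23 x24 x34 b1 b4 = of_int x14" "of_ints x12 x13 x14 x23 x24 x34 b2 b3 = of_int x23"
  "of_ints x12 x13 x14 x23 x24 x34 b2 b4 = of_int x24" "of_ints x12 x13 x14 x23 x24 x34 b3 b4 = of_int x34"
  unfolding of_ints_def coords_basis std_form_def by simp_all

lemma of_ints_H2: "of_ints x12 x13 x14 x23 x24 x34 \<in> H2 \<Lambda>"
proof (rule H2_I[OF basis])
  let ?c = "coords b1 b2 b3 b4"
  have lin: "?c (v + w) = ?c v + ?c w" "?c (r *\<^sub>R v) = r *\<^sub>R ?c v" for v w r
    using linear_coords[OF basis] by (simp_all add: linear_add linear_cmul)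
  show "alternating (of_ints x12 x13 x14 x23 x24 x34)"
    unfolding alternating_def bilinear_def
    by (intro conjI allI linearI) (simp_all add: of_ints_def std_form_def lin algebra_simps)
qed (simp_all add: of_ints_values)

lemma of_ints_eqI:
  assumes "E \<in> H2 \<Lambda>" "E b1 b2 = of_int x12" "E b1 b3 = of_int x13" "E b1 b4 = of_int x14"
    "E b2 b3 = of_int x23" "E b2 b4 = of_int x24" "E b3 b4 = of_int x34"
  shows "E = of_ints x12 x13 x14 x23 x24 x34"
  by (rule alternating_eqI[OF basis H2_alternating[OF assms(1)] H2_alternating[OF of_ints_H2]])
    (simp_all add: assms(2-) of_ints_values)

lemma of_ints_add:
  "of_ints (x12 + y12) (x13 + y13) (x14 + y14) (x23 + y23) (x24 + y24) (x34 + y34) =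
    of_ints x12 x13 x14 x23 x24 x34 + of_ints y12 y13 y14 y23 y24 y34"
  by (rule of_ints_eqI[symmetric]) (simp_all add: H2_add[OF of_ints_H2 of_ints_H2] of_ints_values)

lemma NS_discriminant_pair:
  assumes "NS_basis \<Lambda> = [E, F]"
  shows "NS_discriminant \<Lambda> = intersection \<Lambda> E E * intersection \<Lambda> F F - intersection \<Lambda> E F * intersection \<Lambda> F E"
proof -
  have "gram_matrix \<Lambda> [E, F] \<in> carrier_mat 2 2" by (simp add: gram_matrix_def numeral_2_eq_2)
  from det_2[OF this] show ?thesis
    unfolding NS_discriminant_def assms by (simp add: gram_matrix_def)
qed

text \<open>Since \<open>L b1 b3 = 1\<close>, the class \<open>L\<close> is primitive and extends to a basis of the Neron--Severi
  lattice whose second member vanishes on \<open>(b1, b3)\<close>.\<close>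

lemma NS_basis_L:
  assumes "picard_number \<Lambda> = 2"
  obtains M where "int_basis (NS \<Lambda>) [L, M]" "M \<in> NS \<Lambda>" "M b1 b3 = 0"
    "NS_discriminant \<Lambda> = intersection \<Lambda> L L * intersection \<Lambda> M M - (intersection \<Lambda> L M)\<^sup>2"
proof -
  have "length (NS_basis \<Lambda>) = 2" using assms by (simp add: picard_number_def)
  then obtain E F where EF: "NS_basis \<Lambda> = [E, F]"
    by (metis (no_types, opaque_lifting) One_nat_def Suc_1 length_0_conv length_Suc_conv)
  have ib: "int_basis (NS \<Lambda>) [E, F]" using int_basis_NS_basis[OF basis] unfolding EF .
  then have NS: "NS \<Lambda> = range (\<lambda>(x, y). scale_form x E + scale_form y F)" unfolding int_basis_pair by blast
  have zero: "scale_form 0 G = 0" and one: "scale_form 1 G = G" for G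
    by (intro ext, simp add: scale_form_def)+
  have "scale_form 1 E + scale_form 0 F \<in> NS \<Lambda>" "scale_form 0 E + scale_form 1 F \<in> NS \<Lambda>"
    unfolding NS by (rule image_eqI[of _ _ "(1, 0)"], simp_all) (rule image_eqI[of _ _ "(0, 1)"], simp_all)
  then have mem: "E \<in> NS \<Lambda>" "F \<in> NS \<Lambda>" unfolding zero one by (simp_all only: add_0_left add_0_right)
  obtain x y where L: "L = scale_form x E + scale_form y F" using L_NS NS by auto
  note H2 = NS_H2[OF mem(1)] NS_H2[OF mem(2)]
  obtain u where u: "E b1 b3 = of_int u" using H2_values_int[OF H2(1)] .
  obtain w where w: "F b1 b3 = of_int w" using H2_values_int[OF H2(2)] .
  \<comment> \<open>Evaluating L on (b1, b3) supplies the Bezout relation that extends (x, y) to a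
    unimodular matrix.\<close>
  have "real_of_int (x * u + y * w) = of_int 1"
    using L_values(1) unfolding L by (simp add: scale_form_def u w)
  then have xy: "x * u + y * w = 1" by (simp only: of_int_eq_iff)
  define M where "M = scale_form (- w) E + scale_form u F"
  have ib': "int_basis (NS \<Lambda>) [L, M]"
    unfolding L M_def by (rule int_basis_unimodular[OF ib xy])
  have M: "M \<in> NS \<Lambda>" unfolding M_def NS by (rule image_eqI[of _ _ "(- w, u)"]) simp_all
  have "M b1 b3 = 0" unfolding M_def by (simp add: scale_form_def u w)
  moreover have "NS_discriminant \<Lambda> = intersection \<Lambda> L L * intersection \<Lambda> M M - (intersection \<Lambda> L M)\<^sup>2"
  proof -
    define p q r where pqr: "p = intersection \<Lambda> E E" "q = intersection \<Lambda> E F" "r = intersection \<Lambda> F F"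
    have "intersection \<Lambda> L L * intersection \<Lambda> M M - (intersection \<Lambda> L M)\<^sup>2 = (x * u + y * w)\<^sup>2 * (p * r - q * q)"
      unfolding L M_def intersection_comb_comb[OF H2] pqr[symmetric]
      by (simp add: power2_eq_square algebra_simps)
    then show ?thesis
      unfolding NS_discriminant_pair[OF EF] intersection_commute[OF H2(2,1)] pqr[symmetric] xy by simp
  qed
  ultimately show ?thesis using that ib' M by blast
qed

end

text \<open>With M normalised on (b1, b3), \<open>\<beta>\<close> is its intersection number with L,
  and (P, Q), (R, S) are its coordinates in the two hyperbolic planes orthogonal to L.\<close>

locale picard_number_two_torus = principally_polarized_torus +
  fixes M :: form and P Q R S \<beta> :: int
  assumes NS_LM: "int_basis (NS \<Lambda>) [L, M]" and M_NS: "M \<in> NS \<Lambda>"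
    and M_values: "M b1 b2 = of_int P" "M b1 b3 = 0" "M b1 b4 = of_int R"
      "M b2 b3 = of_int S" "M b2 b4 = of_int \<beta>" "M b3 b4 = of_int Q"
begin

lemma L_H2: "L \<in> H2 \<Lambda>" and M_H2: "M \<in> H2 \<Lambda>"
  by (rule NS_H2[OF L_NS], rule NS_H2[OF M_NS])

lemma intersection_L:
  assumes "F \<in> H2 \<Lambda>" "F b1 b2 = of_int y12" "F b1 b3 = of_int y13" "F b1 b4 = of_int y14"
      "F b2 b3 = of_int y23" "F b2 b4 = of_int y24" "F b3 b4 = of_int y34"
  shows "intersection \<Lambda> F L = y13 + y24"
  using intersection_values[OF assms(1) L_H2 assms(2-), of 0 1 0 0 1 0] L_values by simp

lemma intersection_M:
  assumes "F \<in> H2 \<Lambda>" "F b1 b2 = of_int y12" "F b1 b3 = of_int y13" "F b1 b4 = of_int y14"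
      "F b2 b3 = of_int y23" "F b2 b4 = of_int y24" "F b3 b4 = of_int y34"
  shows "intersection \<Lambda> F M = \<beta> * y13 - (Q * y12 + P * y34 + S * y14 + R * y23)"
  using intersection_values[OF assms(1) M_H2 assms(2-), of P 0 R S \<beta> Q] M_values
  by (simp add: algebra_simps)

lemma intersection_LM:
  "intersection \<Lambda> L L = 2" "intersection \<Lambda> L M = \<beta>" "intersection \<Lambda> M M = - 2 * (P * Q + R * S)"
  using intersection_L[OF L_H2, of 0 1 0 0 1 0] intersection_M[OF L_H2, of 0 1 0 0 1 0]
    intersection_M[OF M_H2, of P 0 R S \<beta> Q] L_values M_values by (simp_all add: algebra_simps)

definition D :: int where "D = \<beta>\<^sup>2 + 4 * (P * Q + R * S)"

lemma NS_eq_LM: "NS \<Lambda> = range (\<lambda>(x, y). scale_form x L + scale_form y M)"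
  and LM_independent: "scale_form x L + scale_form y M = 0 \<Longrightarrow> x = 0 \<and> y = 0"
  using NS_LM unfolding int_basis_pair by blast+

lemma M_nonzero: "M \<noteq> 0"
proof
  assume "M = 0"
  then have "scale_form 0 L + scale_form 1 M = 0" by (intro ext) (simp add: scale_form_def)
  then show False using LM_independent by fastforce
qed

text \<open>The Neron--Severi lattice is saturated in \<open>H\<^sup>2\<close>, so \<open>M\<close> is primitive.\<close>

lemma M_primitive:
  assumes "k dvd \<beta>" "k dvd P" "k dvd Q" "k dvd R" "k dvd S"
  shows "k dvd 1"
proof -
  have altM: "alternating M" using M_NS by (rule NS_alternating)
  have "k \<noteq> 0"
  proof
    assume "k = 0"
    then have "P = 0" "Q = 0" "R = 0" "S = 0" "\<beta> = 0" using assms by auto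
    moreover have "alternating 0"
      using form_subgroup_H2[OF basis] H2_alternating unfolding form_subgroup_def by blast
    ultimately have "M = 0" by (intro alternating_eqI[OF basis altM]) (simp_all add: M_values)
    then show False using M_nonzero by simp
  qed
  define E :: form where "E = (\<lambda>v w. M v w / of_int k)"
  have scale: "scale_form k E = M" using \<open>k \<noteq> 0\<close> by (intro ext) (simp add: scale_form_def E_def)
  have alt: "alternating E"
    using altM unfolding alternating_def bilinear_def E_def linear_iff
    by (simp add: add_divide_distrib del: split_paired_All)
  have int: "of_int x / of_int k \<in> (\<int> :: real set)" if "k dvd x" for x
    using that \<open>k \<noteq> 0\<close> by (auto elim!: dvdE)
  have "E \<in> H2 \<Lambda>"
    by (rule H2_I[OF basis alt]) (simp_all add: E_def M_values int assms)
  moreover have "i_invariant E" using M_NS unfolding NS_iff i_invariant_def E_def by metis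
  ultimately have "E \<in> NS \<Lambda>" by (simp add: NS_iff)
  then obtain x y where xy: "E = scale_form x L + scale_form y M" unfolding NS_eq_LM by auto
  have "scale_form (k * x) L + scale_form (k * y - 1) M = scale_form k E - M"
    unfolding xy by (intro ext) (simp add: scale_form_def algebra_simps)
  also have "\<dots> = 0" unfolding scale by simp
  finally have "k * y - 1 = 0" using LM_independent by blast
  then have "1 = k * y" by simp
  then show ?thesis by (rule dvdI)
qed

text \<open>The Hodge index theorem.\<close>

lemma D_pos: "D > 0"
proof -
  obtain c12 c13 c14 c34 where L: "L = std_form c12 c13 c14 (- c14) c13 c34"
    and c: "c12 < 0" "c12 * c34 - c13\<^sup>2 - c14\<^sup>2 > 0" using L_std .
  obtain d12 d13 d14 d34 where M: "M = std_form d12 d13 d14 (- d14) d13 d34" using NS_std[OF M_NS] .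
  let ?W = "\<lambda>E F. wedge E F (1, 0) (\<i>, 0) (0, 1) (0, \<i>)"
  have indep: "\<not> (d12 = t * c12 \<and> d13 = t * c13 \<and> d14 = t * c14 \<and> d34 = t * c34)" for t
  proof
    assume "d12 = t * c12 \<and> d13 = t * c13 \<and> d14 = t * c14 \<and> d34 = t * c34"
    then have eq: "M v w = t * L v w" for v w unfolding L M by (simp add: std_form_def algebra_simps)
    from this[of b1 b3] have "t = 0" using L_values M_values by simp
    then have "M = 0" using eq by (intro ext) simp
    then show False using M_nonzero by simp
  qed
  have wb: "wedge E F b1 b2 b3 b4 = volume b1 b2 b3 b4 * ?W E F" if "E \<in> NS \<Lambda>" "F \<in> NS \<Lambda>" for E F
    by (rule wedge_basis_std[OF NS_alternating[OF that(1)] NS_alternating[OF that(2)]])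
  have "c12 \<noteq> 0" using c by simp
  then have "(?W L M)\<^sup>2 > ?W L L * ?W M M"
    unfolding L M wedge_std_std
    using Hodge_index_std[OF _ c(2) indep] by (simp add: algebra_simps)
  \<comment> \<open>The squared volume carries the inequality from the standard basis to the lattice
    basis, where it is a statement on integers.\<close>
  then have "(volume b1 b2 b3 b4)\<^sup>2 * ((?W L M)\<^sup>2 - ?W L L * ?W M M) > 0"
    using volume_basis_neg by simp
  also have "(volume b1 b2 b3 b4)\<^sup>2 * ((?W L M)\<^sup>2 - ?W L L * ?W M M) =
    (volume b1 b2 b3 b4 * ?W L M)\<^sup>2 - (volume b1 b2 b3 b4 * ?W L L) * (volume b1 b2 b3 b4 * ?W M M)"
    by (simp add: power2_eq_square algebra_simps)
  also have "\<dots> = (wedge L M b1 b2 b3 b4)\<^sup>2 - wedge L L b1 b2 b3 b4 * wedge M M b1 b2 b3 b4"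
    by (simp only: wb[OF L_NS L_NS] wb[OF L_NS M_NS] wb[OF M_NS M_NS])
  also have "\<dots> = of_int D"
    by (simp add: wedge_def L_values M_values D_def power2_eq_square algebra_simps)
  finally show ?thesis by simp
qed

lemma D_mod_4: "D mod 4 = 0 \<or> D mod 4 = 1"
proof -
  have "\<beta>\<^sup>2 mod 4 = 0 \<or> \<beta>\<^sup>2 mod 4 = 1"
  proof (cases "even \<beta>")
    case True
    then obtain j where "\<beta> = 2 * j" by auto
    then have "\<beta>\<^sup>2 = 4 * j\<^sup>2" by (simp add: power2_eq_square)
    then show ?thesis by simp
  next
    case False
    then obtain j where "\<beta> = 2 * j + 1" by (elim oddE)
    then have "\<beta>\<^sup>2 = 4 * (j\<^sup>2 + j) + 1" by (simp add: power2_eq_square algebra_simps)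
    then show ?thesis by presburger
  qed
  then show ?thesis unfolding D_def by presburger
qed

section \<open>Coordinates on the transcendental and Mukai lattices\<close>

lemma transcendental_iff:
  "F \<in> transcendental \<Lambda> \<longleftrightarrow> F \<in> H2 \<Lambda> \<and> intersection \<Lambda> F L = 0 \<and> intersection \<Lambda> F M = 0"
proof -
  have "intersection \<Lambda> F E = 0"
    if F: "F \<in> H2 \<Lambda>" "intersection \<Lambda> F L = 0" "intersection \<Lambda> F M = 0" and E: "E \<in> NS \<Lambda>" for E
  proof -
    obtain x y where xy: "E = scale_form x L + scale_form y M" using E unfolding NS_eq_LM by auto
    show ?thesis
      unfolding intersection_commute[OF F(1) NS_H2[OF E]]
      unfolding xy intersection_comb_left[OF L_H2 M_H2 F(1)]
        intersection_commute[OF L_H2 F(1)] intersection_commute[OF M_H2 F(1)] F(2,3) by simp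
  qed
  then show ?thesis unfolding transcendental_def using L_NS M_NS by blast
qed

text \<open>Orthogonality to L forces opposite values on (b1, b3) and (b2, b4), leaving five
  integers; orthogonality to M is then membership in \<open>quint_section\<close>, to which the
  descent applies for any admissible b and c.\<close>

lemma transcendental_coords:
  assumes D: "D = b\<^sup>2 + 4 * c"
  obtains \<tau> where "bij_betw \<tau> UNIV (transcendental \<Lambda>)" "\<And>X Y. \<tau> (X + Y) = \<tau> X + \<tau> Y"
    "\<And>X. intersection \<Lambda> (\<tau> X) (\<tau> X) = - 2 * hyp_form b c X"
proof -
  have "hyp_split b c \<beta> P Q R S"
    by (rule hyp_split_primitive) (use M_primitive D D_def in auto)
  then obtain \<phi> where \<phi>: "bij_betw \<phi> UNIV (quint_section \<beta> P Q R S)" "\<And>X Y. \<phi> (X + Y) = \<phi> X + \<phi> Y"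
    "\<And>X. quint_form (\<phi> X) = hyp_form b c X" unfolding hyp_split_def by blast
  define g :: "int5 \<Rightarrow> form" where "g = (\<lambda>(p, x, y, z, w). of_ints x p z w (- p) y)"
  have gH2: "g Y \<in> H2 \<Lambda>" for Y by (cases Y) (simp add: g_def of_ints_H2)
  have LM: "intersection \<Lambda> (g (p, x, y, z, w)) L = 0"
    "intersection \<Lambda> (g (p, x, y, z, w)) M = \<beta> * p - (Q * x + P * y + S * z + R * w)" for p x y z w
    unfolding g_def prod.case intersection_L[OF of_ints_H2 of_ints_values]
      intersection_M[OF of_ints_H2 of_ints_values] by simp_all
  have "bij_betw g (quint_section \<beta> P Q R S) (transcendental \<Lambda>)"
  proof (rule bij_betw_imageI)
    show "inj_on g (quint_section \<beta> P Q R S)"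
    proof (rule inj_onI)
      fix X Y assume eq: "g X = g Y"
      obtain p x y z w where X: "X = (p, x, y, z, w)" by (cases X)
      obtain p' x' y' z' w' where Y: "Y = (p', x', y', z', w')" by (cases Y)
      have "of_ints x p z w (- p) y = of_ints x' p' z' w' (- p') y'" using eq unfolding X Y g_def by simp
      then have "real_of_int x = of_int x'" "real_of_int p = of_int p'" "real_of_int z = of_int z'"
        "real_of_int w = of_int w'" "real_of_int y = of_int y'" using of_ints_values by metis+
      then show "X = Y" unfolding X Y by simp
    qed
    show "g ` quint_section \<beta> P Q R S = transcendental \<Lambda>"
    proof
      show "g ` quint_section \<beta> P Q R S \<subseteq> transcendental \<Lambda>"
      proof (rule image_subsetI)
        fix X assume "X \<in> quint_section \<beta> P Q R S"
        then obtain p x y z w where "X = (p, x, y, z, w)" "\<beta> * p = Q * x + P * y + S * z + R * w"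
          unfolding quint_section_def by blast
        then show "g X \<in> transcendental \<Lambda>" unfolding transcendental_iff using gH2 LM by simp
      qed
      show "transcendental \<Lambda> \<subseteq> g ` quint_section \<beta> P Q R S"
      proof
        fix F assume F: "F \<in> transcendental \<Lambda>"
        then have H2: "F \<in> H2 \<Lambda>" and 0: "intersection \<Lambda> F L = 0" "intersection \<Lambda> F M = 0"
          unfolding transcendental_iff by auto
        obtain y12 y13 y14 y23 y24 y34 where y: "F b1 b2 = of_int y12" "F b1 b3 = of_int y13"
          "F b1 b4 = of_int y14" "F b2 b3 = of_int y23" "F b2 b4 = of_int y24" "F b3 b4 = of_int y34"
          using H2_values_int[OF H2] .
        have y24: "y24 = - y13" using 0(1) unfolding intersection_L[OF H2 y] by simp
        have "\<beta> * y13 = Q * y12 + P * y34 + S * y14 + R * y23"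
          using 0(2) unfolding intersection_M[OF H2 y] by simp
        then have "(y13, y12, y34, y14, y23) \<in> quint_section \<beta> P Q R S" by (simp add: quint_section_def)
        moreover have "F = g (y13, y12, y34, y14, y23)"
          unfolding g_def prod.case y24[symmetric] by (rule of_ints_eqI[OF H2 y])
        ultimately show "F \<in> g ` quint_section \<beta> P Q R S" by blast
      qed
    qed
  qed
  with \<phi>(1) have bij: "bij_betw (g \<circ> \<phi>) UNIV (transcendental \<Lambda>)" by (rule bij_betw_trans)
  have g_add: "g (X + Y) = g X + g Y" for X Y
  proof -
    obtain p x y z w where X: "X = (p, x, y, z, w)" by (cases X)
    obtain p' x' y' z' w' where Y: "Y = (p', x', y', z', w')" by (cases Y)
    have "of_ints (x + x') (p + p') (z + z') (w + w') (- p + - p') (y + y') =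
      of_ints x p z w (- p) y + of_ints x' p' z' w' (- p') y'" by (rule of_ints_add)
    then show ?thesis unfolding X Y g_def add_Pair prod.case by (simp only: minus_add_distrib)
  qed
  have g_form: "intersection \<Lambda> (g X) (g X) = - 2 * quint_form X" for X
  proof -
    obtain p x y z w where X: "X = (p, x, y, z, w)" by (cases X)
    show ?thesis
      unfolding X g_def prod.case intersection_values[OF of_ints_H2 of_ints_H2 of_ints_values of_ints_values]
      by (simp add: power2_eq_square)
  qed
  show ?thesis
    by (rule that[OF bij]) (simp_all add: \<phi>(2,3) g_add g_form)
qed

text \<open>In the basis L, M + h L the middle coefficient of q becomes \<open>\<beta>\<close> + 2 h
  = b. The sign of v turns the Mukai term - r s into + u v.\<close>

lemma mukai_coords:
  assumes D: "D = b\<^sup>2 + 4 * c"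
  obtains \<eta> where "bij_betw \<eta> UNIV (mukai_lattice \<Lambda>)" "\<And>X Y. \<eta> (X + Y) = \<eta> X + \<eta> Y"
    "\<And>X. mukai_pairing \<Lambda> (\<eta> X) (\<eta> X) = 2 * hyp_form b c X"
proof -
  have "\<beta>\<^sup>2 = b\<^sup>2 + 2 * (2 * c - 2 * (P * Q + R * S))" using D unfolding D_def by simp
  then have "even (\<beta>\<^sup>2) = even (b\<^sup>2)" by simp
  then have "even (b - \<beta>)" by simp
  then obtain h where "b - \<beta> = 2 * h" by (rule evenE)
  then have b: "b = \<beta> + 2 * h" by simp
  have c: "c = P * Q + R * S - \<beta> * h - h\<^sup>2"
    using D unfolding D_def b by (simp add: power2_eq_square algebra_simps)
  define \<eta> :: "int4 \<Rightarrow> int \<times> form \<times> int" where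
    "\<eta> = (\<lambda>(u, v, k, m). (u, scale_form (k + h * m) L + scale_form m M, - v))"
  have "bij_betw \<eta> UNIV (mukai_lattice \<Lambda>)"
  proof (rule bij_betw_imageI)
    show "inj \<eta>"
    proof (rule injI)
      fix X Y assume eq: "\<eta> X = \<eta> Y"
      obtain u v k m where X: "X = (u, v, k, m)" by (cases X)
      obtain u' v' k' m' where Y: "Y = (u', v', k', m')" by (cases Y)
      have uv: "u = u'" "v = v'" and f: "scale_form (k + h * m) L + scale_form m M = scale_form (k' + h * m') L + scale_form m' M"
        using eq unfolding X Y \<eta>_def by simp_all
      have "scale_form ((k + h * m) - (k' + h * m')) L + scale_form (m - m') M =
        (scale_form (k + h * m) L + scale_form m M) - (scale_form (k' + h * m') L + scale_form m' M)"
        by (intro ext) (simp add: scale_form_def algebra_simps)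
      also have "\<dots> = 0" unfolding f by (rule diff_self)
      finally have "(k + h * m) - (k' + h * m') = 0 \<and> m - m' = 0" by (rule LM_independent)
      then show "X = Y" unfolding X Y using uv by auto
    qed
    show "range \<eta> = mukai_lattice \<Lambda>"
    proof
      show "range \<eta> \<subseteq> mukai_lattice \<Lambda>"
        unfolding mukai_lattice_def NS_eq_LM \<eta>_def by auto
      show "mukai_lattice \<Lambda> \<subseteq> range \<eta>"
      proof
        fix N assume "N \<in> mukai_lattice \<Lambda>"
        then obtain r x y s where "N = (r, scale_form x L + scale_form y M, s)"
          unfolding mukai_lattice_def NS_eq_LM by auto
        then have "N = \<eta> (r, - s, x - h * y, y)" unfolding \<eta>_def by simp
        then show "N \<in> range \<eta>" by blast
      qed
    qed
  qed
  moreover have "\<eta> (X + Y) = \<eta> X + \<eta> Y" for X Y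
  proof -
    obtain u v k m where X: "X = (u, v, k, m)" by (cases X)
    obtain u' v' k' m' where Y: "Y = (u', v', k', m')" by (cases Y)
    have "scale_form (k + k' + h * (m + m')) L + scale_form (m + m') M =
      (scale_form (k + h * m) L + scale_form m M) + (scale_form (k' + h * m') L + scale_form m' M)"
      by (intro ext) (simp add: scale_form_def algebra_simps)
    then show ?thesis unfolding X Y \<eta>_def add_Pair prod.case by (simp only: minus_add_distrib)
  qed
  moreover have "mukai_pairing \<Lambda> (\<eta> X) (\<eta> X) = 2 * hyp_form b c X" for X
  proof -
    obtain u v k m where X: "X = (u, v, k, m)" by (cases X)
    show ?thesis
      unfolding X \<eta>_def prod.case mukai_pairing.simps intersection_comb_comb[OF L_H2 M_H2] intersection_LM
        hyp_form.simps b c by (simp add: power2_eq_square algebra_simps)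
  qed
  ultimately show ?thesis by (rule that)
qed

lemma sym_biadditive_transcendental: "sym_biadditive (transcendental \<Lambda>) (intersection \<Lambda>)"
proof -
  have "F + G \<in> transcendental \<Lambda>" if "F \<in> transcendental \<Lambda>" "G \<in> transcendental \<Lambda>" for F G
    using that unfolding transcendental_iff
    by (simp add: H2_add intersection_add_left L_H2 M_H2)
  moreover have "transcendental \<Lambda> \<subseteq> H2 \<Lambda>" by (auto simp: transcendental_def)
  ultimately show ?thesis
    using sym_biadditive_intersection unfolding sym_biadditive_def by (metis subsetD)
qed

lemma sym_biadditive_mukai: "sym_biadditive (mukai_lattice \<Lambda>) (mukai_pairing \<Lambda>)"
  unfolding sym_biadditive_def
proof (intro conjI ballI)
  fix x y assume "x \<in> mukai_lattice \<Lambda>" "y \<in> mukai_lattice \<Lambda>"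
  then obtain r E s r' E' s' where x: "x = (r, E, s)" and y: "y = (r', E', s')"
    and NS: "E \<in> NS \<Lambda>" "E' \<in> NS \<Lambda>" unfolding mukai_lattice_def by auto
  show "x + y \<in> mukai_lattice \<Lambda>" unfolding x y mukai_lattice_def
    using form_subgroup_add[OF form_subgroup_NS[OF basis] NS] by simp
  show "mukai_pairing \<Lambda> x y = mukai_pairing \<Lambda> y x" unfolding x y
    using intersection_commute[OF NS_H2[OF NS(1)] NS_H2[OF NS(2)]] by (simp add: algebra_simps)
  fix z assume "z \<in> mukai_lattice \<Lambda>"
  then obtain t F u where z: "z = (t, F, u)" and F: "F \<in> NS \<Lambda>" unfolding mukai_lattice_def by auto
  show "mukai_pairing \<Lambda> (x + y) z = mukai_pairing \<Lambda> x z + mukai_pairing \<Lambda> y z"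
    unfolding x y z add_Pair mukai_pairing.simps
      intersection_add_left[OF NS_H2[OF NS(1)] NS_H2[OF NS(2)] NS_H2[OF F]] by (simp add: algebra_simps)
qed

lemma self_mirror_iff_negation:
  assumes "D = b\<^sup>2 + 4 * c"
  shows "self_mirror \<Lambda> \<longleftrightarrow> (\<exists>\<psi>. bij \<psi> \<and> (\<forall>X Y. \<psi> (X + Y) = \<psi> X + \<psi> Y) \<and>
    (\<forall>X. hyp_form b c (\<psi> X) = - hyp_form b c X))"
proof -
  obtain \<tau> where \<tau>: "bij_betw \<tau> UNIV (transcendental \<Lambda>)" "\<And>X Y. \<tau> (X + Y) = \<tau> X + \<tau> Y"
    "\<And>X. intersection \<Lambda> (\<tau> X) (\<tau> X) = - 2 * hyp_form b c X" using transcendental_coords[OF assms] by metis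
  obtain \<eta> where \<eta>: "bij_betw \<eta> UNIV (mukai_lattice \<Lambda>)" "\<And>X Y. \<eta> (X + Y) = \<eta> X + \<eta> Y"
    "\<And>X. mukai_pairing \<Lambda> (\<eta> X) (\<eta> X) = 2 * hyp_form b c X" using mukai_coords[OF assms] by metis
  show ?thesis unfolding self_mirror_def
    by (rule lattice_isometry_coords_iff[where p = "intersection \<Lambda>" and q = "mukai_pairing \<Lambda>"
          and \<tau> = \<tau> and \<eta> = \<eta> and h = "hyp_form b c", OF sym_biadditive_transcendental sym_biadditive_mukai \<tau> \<eta>])
qed

text \<open>Two presentations of the same D are used: b = \<open>\<beta>\<close> for necessity, and
  b = a, c = s^2 for sufficiency.\<close>

theorem self_mirror_iff:
  "self_mirror \<Lambda> \<longleftrightarrow> \<not> 16 dvd D \<and> (\<forall>p::nat. prime p \<and> [p = 3] (mod 4) \<longrightarrow> \<not> int p dvd D)"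
proof
  assume "self_mirror \<Lambda>"
  then obtain \<psi> :: "int4 \<Rightarrow> int4" where \<psi>: "bij \<psi>" "\<And>X Y. \<psi> (X + Y) = \<psi> X + \<psi> Y"
    "\<And>X. hyp_form \<beta> (P * Q + R * S) (\<psi> X) = - hyp_form \<beta> (P * Q + R * S) X"
    using self_mirror_iff_negation[OF D_def] by blast
  have "\<beta>\<^sup>2 + 4 * (P * Q + R * S) \<noteq> 0" using D_pos unfolding D_def by simp
  from hyp_form_negation_square[OF bij_is_surj[OF \<psi>(1)] \<psi>(2,3) this]
  obtain m where m: "D dvd m\<^sup>2 + 4" unfolding D_def by blast
  show "\<not> 16 dvd D \<and> (\<forall>p::nat. prime p \<and> [p = 3] (mod 4) \<longrightarrow> \<not> int p dvd D)"
  proof (intro conjI allI impI notI)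
    assume "16 dvd D"
    then show False using m not_16_dvd_square_plus_4 dvd_trans by blast
  next
    fix p :: nat assume "prime p \<and> [p = 3] (mod 4)" "int p dvd D"
    then show False using m prime_3_mod_4_not_dvd dvd_trans by blast
  qed
next
  assume h: "\<not> 16 dvd D \<and> (\<forall>p::nat. prime p \<and> [p = 3] (mod 4) \<longrightarrow> \<not> int p dvd D)"
  have "\<exists>a s :: int. D = a\<^sup>2 + 4 * s\<^sup>2 \<and> coprime a s"
    by (rule sum_square_four_squares[OF D_pos D_mod_4]) (use h in blast)+
  then obtain a s where as: "D = a\<^sup>2 + 4 * s\<^sup>2" "coprime a s" by blast
  obtain \<phi> :: "int4 \<Rightarrow> int4" where "bij \<phi>" "\<And>X Y. \<phi> (X + Y) = \<phi> X + \<phi> Y"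
    "\<And>X. hyp_form a (s\<^sup>2) (\<phi> X) = - hyp_form a (s\<^sup>2) X" using hyp_form_negation[OF as(2)] by metis
  then show "self_mirror \<Lambda>" unfolding self_mirror_iff_negation[OF as(1)] by blast
qed

end

theorem corollary1p8:
  fixes \<Lambda> :: "C2 set" and L :: form
  assumes "abelian_surface \<Lambda>"
    and "principal_polarization \<Lambda> L"
    and "picard_number \<Lambda> = 2"
  shows "self_mirror \<Lambda> \<longleftrightarrow>
    \<not> 16 dvd NS_discriminant \<Lambda> \<and>
    (\<forall>p::nat. prime p \<and> [p = 3] (mod 4) \<longrightarrow> \<not> int p dvd NS_discriminant \<Lambda>)"
proof -
  obtain b1 b2 b3 b4 where "lattice_basis \<Lambda> b1 b2 b3 b4" "polarization \<Lambda> L"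
    "L b1 b3 = 1" "L b2 b4 = 1" "L b1 b2 = 0" "L b1 b4 = 0" "L b2 b3 = 0" "L b3 b4 = 0"
    using assms(2) unfolding principal_polarization_def by blast
  then interpret principally_polarized_torus \<Lambda> L b1 b2 b3 b4 by unfold_locales
  obtain M where M: "int_basis (NS \<Lambda>) [L, M]" "M \<in> NS \<Lambda>" "M b1 b3 = 0"
    and disc: "NS_discriminant \<Lambda> = intersection \<Lambda> L L * intersection \<Lambda> M M - (intersection \<Lambda> L M)\<^sup>2"
    using NS_basis_L[OF assms(3)] .
  obtain P x R S \<beta> Q where "M b1 b2 = of_int P" "M b1 b3 = of_int x" "M b1 b4 = of_int R"
    "M b2 b3 = of_int S" "M b2 b4 = of_int \<beta>" "M b3 b4 = of_int Q"
    using H2_values_int[OF NS_H2[OF M(2)]] .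
  then interpret picard_number_two_torus \<Lambda> L b1 b2 b3 b4 M P Q R S \<beta>
    using M by unfold_locales
  \<comment> \<open>The Gram entries 2, \<open>\<beta>\<close> and -2 (P Q + R S) give this sign,
    which divisibility does not see.\<close>
  have "NS_discriminant \<Lambda> = - D"
    unfolding disc intersection_LM D_def by (simp add: algebra_simps)
  then show ?thesis using self_mirror_iff by simp
qed

end
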